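(* Let $G$ be a finite connected simple graph with $n\ge 2$ vertices and $n-1+n_L$ edges (so $G$ has $n_L\ge 0$ independent closed loops), and let $H$ be an instance of random 2-QSAT over $G$. Then, with probability $1$ with respect to the choice of projectors: (i) if $n_L=0$ ($G$ is a tree), $\dim\ker(H)=n+1$; (ii) if $n_L=1$, $\dim\ker(H)=2$; (iii) if $n_L\ge 2$, $\ker(H)=\{0\}$, i.e. $H$ is unsatisfiable.
   Context: Each vertex of $G$ carries a qubit $\mathbb{C}^2$, and the full Hilbert space is $(\mathbb{C}^2)^{\otimes n}$. For each edge $I=\{i,j\}$ of $G$ a unit vector $|\phi_I\rangle$ in the $4$-dimensional Hilbert space of the qubits $i,j$ is chosen, independently for different edges and uniformly (Haar measure) on the unit sphere. $\Pi^{I}_{\phi_I}$ denotes $|\phi_I\rangle\langle\phi_I|$ acting on the qubits in $I$, tensored with the identity on the remaining qubits. An instance of random 2-QSAT over $G$ is the operator $H=\sum_{I}\Pi^{I}_{\phi_I}$, the sum running over all edges of $G$. *)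

theory Defs
  imports "HOL-Probability.Probability"
begin

text \<open>A graph whose vertex set is the finite type \<open>'v\<close> is given by its set of edges.\<close>

definition simple_graph :: "'v set set \<Rightarrow> bool" where
  "simple_graph E \<longleftrightarrow> (\<forall>I\<in>E. card I = 2)"

definition connected_graph :: "'v set set \<Rightarrow> bool" where
  "connected_graph E \<longleftrightarrow> (\<forall>u v. (u, v) \<in> {(a, b). {a, b} \<in> E}\<^sup>*)"

text \<open>
  The index type \<open>2\<close> labels the computational basis of one qubit. Two ordered qubits live in
  \<open>complex ^ (2 \<times> 2)\<close>, and the qubits on the vertices \<open>'v\<close> live in \<open>complex ^ ('v \<Rightarrow> 2)\<close>: the
  product basis of the tensor power is indexed by the assignments \<open>'v \<Rightarrow> 2\<close>.
\<close>

type_synonym two_qubits = "complex ^ (2 \<times> 2)"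
type_synonym 'v qubits = "complex ^ ('v \<Rightarrow> 2)"
type_synonym 'v qubits_op = "complex ^ ('v \<Rightarrow> 2) ^ ('v \<Rightarrow> 2)"

definition ketbra :: "two_qubits \<Rightarrow> complex ^ (2 \<times> 2) ^ (2 \<times> 2)" where
  "ketbra \<phi> = (\<chi> a b. \<phi> $ a * cnj (\<phi> $ b))"

text \<open>
  The operator \<open>A\<close> on the qubits \<open>i\<close> (first tensor factor) and \<open>j\<close> (second tensor factor),
  tensored with the identity on all other qubits.
\<close>

definition act_on :: "'v \<times> 'v \<Rightarrow> complex ^ (2 \<times> 2) ^ (2 \<times> 2) \<Rightarrow> 'v::finite qubits_op" where
  "act_on = (\<lambda>(i, j) A. \<chi> x y.
     if \<forall>k. k \<notin> {i, j} \<longrightarrow> x k = y k then A $ (x i, x j) $ (y i, y j) else 0)"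

text \<open>
  \<open>ends I\<close> lists the two end points of the edge \<open>I\<close>, thereby identifying the space of the two
  qubits in \<open>I\<close> with \<open>two_qubits\<close>.
\<close>

definition qsat_hamiltonian ::
    "('v set \<Rightarrow> 'v \<times> 'v) \<Rightarrow> 'v set set \<Rightarrow> ('v set \<Rightarrow> two_qubits) \<Rightarrow> 'v::finite qubits_op" where
  "qsat_hamiltonian ends E \<phi> = (\<Sum>I\<in>E. act_on (ends I) (ketbra (\<phi> I)))"

definition op_kernel :: "'v::finite qubits_op \<Rightarrow> 'v qubits set" where
  "op_kernel H = {\<psi>. H *v \<psi> = 0}"

text \<open>
  The uniform probability measure on the unit sphere, as a Borel measure on the ambient space:
  the distribution of the direction of a uniform random point of the unit ball. By the lemmas
  below, it is a probability measure concentrated on the sphere and invariant under all orthogonal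
  maps, hence under the unitary maps of \<open>two_qubits\<close>; this characterises the Haar measure.
\<close>

definition uniform_sphere :: "'a::euclidean_space measure" where
  "uniform_sphere = distr (uniform_measure lborel (cball 0 1)) borel sgn"

definition random_2qsat :: "'v set set \<Rightarrow> ('v set \<Rightarrow> two_qubits) measure" where
  "random_2qsat E = PiM E (\<lambda>_. uniform_sphere)"

lemma borel_measurable_sgn_euclidean: "(sgn :: 'a::euclidean_space \<Rightarrow> 'a) \<in> borel_measurable borel"
  unfolding sgn_div_norm[abs_def] by measurable

lemma prob_space_uniform_sphere: "prob_space (uniform_sphere :: 'a::euclidean_space measure)"
proof -
  have "emeasure lborel (cball 0 1 :: 'a set) \<noteq> 0"
    using emeasure_cball[of 1 "0::'a"] by (simp add: unit_ball_vol_pos less_imp_neq[symmetric])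
  moreover have "emeasure lborel (cball 0 1 :: 'a set) \<noteq> \<infinity>"
    using emeasure_lborel_cball_finite[of "0::'a" 1] by simp
  ultimately interpret prob_space "uniform_measure lborel (cball 0 1 :: 'a set)"
    by (rule prob_space_uniform_measure)
  show ?thesis unfolding uniform_sphere_def
    by (rule prob_space_distr) (simp add: borel_measurable_sgn_euclidean)
qed

lemma AE_uniform_sphere: "AE x in (uniform_sphere :: 'a::euclidean_space measure). norm x = 1"
proof -
  have "AE x in uniform_measure lborel (cball 0 1 :: 'a set). norm (sgn x) = 1"
  proof (rule AE_uniform_measureI)
    show "AE x in lborel. x \<in> cball 0 1 \<longrightarrow> norm (sgn x :: 'a) = 1"
      using AE_lborel_singleton[of "0::'a"] by eventually_elim (simp add: norm_sgn)
  qed simp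
  then show ?thesis unfolding uniform_sphere_def
    by (subst AE_distr_iff) (simp_all add: borel_measurable_sgn_euclidean)
qed

text \<open>
  Integrating over two points shows that a translation invariant measure that agrees with \<open>lborel\<close>
  on the unit ball is \<open>lborel\<close>.
\<close>

lemma lborel_distr_orthogonal:
  fixes f :: "'a::euclidean_space \<Rightarrow> 'a"
  assumes "orthogonal_transformation f"
  shows "distr lborel borel f = lborel"
proof (rule measure_eqI)
  let ?M = "distr lborel borel f"
  let ?B = "cball 0 1 :: 'a set"
  obtain g where g: "orthogonal_transformation g" "\<And>x. g (f x) = x" "\<And>y. f (g y) = y"
    using orthogonal_transformation_inv[OF assms] orthogonal_transformation_bij[OF assms]
    by (metis bij_inv_eq_iff)
  have lf: "linear f" and lg: "linear g"
    using assms g by (auto simp: orthogonal_transformation_def)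
  have mf[measurable]: "f \<in> borel_measurable borel" and mg[measurable]: "g \<in> borel_measurable borel"
    using lf lg by (auto intro!: borel_measurable_continuous_onI linear_continuous_on simp: linear_conv_bounded_linear)
  have ball: "emeasure ?M ?B = emeasure lborel ?B"
  proof -
    have "f -` ?B = ?B"
      using assms by (auto simp: orthogonal_transformation_norm)
    then show ?thesis by (simp add: emeasure_distr)
  qed
  have fin: "emeasure lborel ?B \<noteq> \<infinity>"
    using emeasure_lborel_cball_finite[of "0::'a" 1] by simp
  have pos: "emeasure lborel ?B \<noteq> 0"
    using emeasure_cball[of 1 "0::'a"] by (simp add: unit_ball_vol_pos less_imp_neq[symmetric])
  have trl: "(\<integral>\<^sup>+x. h (c + x) \<partial>lborel) = (\<integral>\<^sup>+x. h x \<partial>lborel)"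
    if [measurable]: "h \<in> borel_measurable borel" for h and c :: 'a
    by (subst (2) lborel_distr_plus[symmetric, of c]) (simp add: nn_integral_distr add.commute)
  have refl: "(\<integral>\<^sup>+x. h (c - x) \<partial>lborel) = (\<integral>\<^sup>+x. h x \<partial>lborel)"
    if [measurable]: "h \<in> borel_measurable borel" for h and c :: 'a
    by (subst (2) lborel_affine[of "-1" c])
       (simp_all add: nn_integral_density nn_integral_distr)
  fix A :: "'a set" assume "A \<in> sets ?M"
  then have [measurable]: "A \<in> sets borel" by simp
  let ?i = "indicator :: 'a set \<Rightarrow> 'a \<Rightarrow> ennreal"
  have [measurable]: "?B \<in> sets borel" by simp
  have f_diff: "f (x - g y) = f x - y" for x y
    using linear_diff[OF lf, of x "g y"] g by simp
  have A_int: "(\<integral>\<^sup>+x. ?i A (f x) \<partial>lborel) = emeasure ?M A"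
    using nn_integral_distr[of f lborel borel "?i A"] by simp
  have B_int: "(\<integral>\<^sup>+x. ?i ?B (f x) \<partial>lborel) = emeasure ?M ?B"
    using nn_integral_distr[of f lborel borel "?i ?B"] by simp
  have "emeasure ?M A * emeasure lborel ?B
      = (\<integral>\<^sup>+x. \<integral>\<^sup>+y. ?i A (f x) * ?i ?B y \<partial>lborel \<partial>lborel)"
    by (simp add: nn_integral_cmult nn_integral_multc A_int)
  also have "\<dots> = (\<integral>\<^sup>+x. \<integral>\<^sup>+y. ?i A (f x) * ?i ?B (f x + y) \<partial>lborel \<partial>lborel)"
    by (intro nn_integral_cong trl[symmetric]) measurable
  also have "\<dots> = (\<integral>\<^sup>+y. \<integral>\<^sup>+x. ?i A (f x) * ?i ?B (f x + y) \<partial>lborel \<partial>lborel)"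
    by (rule lborel_pair.Fubini'[symmetric]) measurable
  also have "\<dots> = (\<integral>\<^sup>+y. \<integral>\<^sup>+x. ?i A (f x - y) * ?i ?B (f x) \<partial>lborel \<partial>lborel)"
  proof (rule nn_integral_cong)
    fix y :: 'a
    show "(\<integral>\<^sup>+x. ?i A (f x) * ?i ?B (f x + y) \<partial>lborel) = (\<integral>\<^sup>+x. ?i A (f x - y) * ?i ?B (f x) \<partial>lborel)"
      using trl[of "\<lambda>x. ?i A (f x) * ?i ?B (f x + y)" "- g y"] by (simp add: f_diff)
  qed
  also have "\<dots> = (\<integral>\<^sup>+x. \<integral>\<^sup>+y. ?i A (f x - y) * ?i ?B (f x) \<partial>lborel \<partial>lborel)"
    by (rule lborel_pair.Fubini') measurable
  also have "\<dots> = (\<integral>\<^sup>+x. emeasure lborel A * ?i ?B (f x) \<partial>lborel)"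
    by (simp add: nn_integral_multc refl)
  also have "\<dots> = emeasure lborel A * emeasure lborel ?B"
    by (simp add: nn_integral_cmult B_int ball)
  finally show "emeasure ?M A = emeasure lborel A"
    using fin pos by (metis infinity_ennreal_def mult_divide_eq_ennreal)
qed simp

lemma uniform_sphere_orthogonal_invariant:
  fixes f :: "'a::euclidean_space \<Rightarrow> 'a"
  assumes f: "orthogonal_transformation f"
  shows "distr uniform_sphere borel f = uniform_sphere"
proof -
  have lf: "linear f" using f by (simp add: orthogonal_transformation_def)
  have mf[measurable]: "f \<in> borel_measurable borel"
    using lf by (auto intro!: borel_measurable_continuous_onI linear_continuous_on simp: linear_conv_bounded_linear)
  note [measurable] = borel_measurable_sgn_euclidean
  let ?U = "uniform_measure lborel (cball 0 1) :: 'a measure"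
  have nf: "norm (f x) = norm x" for x using f by (rule orthogonal_transformation_norm)
  have fsgn: "f (sgn x) = sgn (f x)" for x
    by (simp add: sgn_div_norm nf linear_cmul[OF lf])
  have U: "distr ?U borel f = ?U"
  proof (rule measure_eqI)
    fix A assume "A \<in> sets (distr ?U borel f)"
    then have [measurable]: "A \<in> sets borel" by simp
    have "cball 0 1 \<inter> f -` A = f -` (cball 0 1 \<inter> A)" by (auto simp: nf)
    moreover have "emeasure lborel (f -` (cball 0 1 \<inter> A)) = emeasure lborel (cball 0 1 \<inter> A)"
      by (subst (2) lborel_distr_orthogonal[OF f, symmetric]) (simp add: emeasure_distr)
    moreover have "f -` A \<in> sets borel" using measurable_sets[OF mf, of A] by simp
    ultimately show "emeasure (distr ?U borel f) A = emeasure ?U A"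
      by (simp add: emeasure_distr)
  qed simp
  have "distr uniform_sphere borel f = distr ?U borel (\<lambda>x. sgn (f x))"
    unfolding uniform_sphere_def by (subst distr_distr) (simp_all add: o_def fsgn)
  also have "\<dots> = distr (distr ?U borel f) borel sgn"
    by (subst distr_distr) (simp_all add: o_def)
  also have "\<dots> = uniform_sphere" by (simp add: U uniform_sphere_def)
  finally show ?thesis .
qed

end

theory Submission
  imports Defs
begin

text \<open>
  The kernel of a sum of projectors is the intersection of their kernels, so a state is in
  \<open>ker H\<close> iff every edge \<open>I\<close> annihilates it through the \<open>2 \<times> 2\<close> matrix \<open>M\<^sub>I\<close> of conjugated
  amplitudes of \<open>\<phi>\<^sub>I\<close>. An invertible change of basis \<open>h\<^sub>v\<close> at every vertex replaces \<open>M\<^sub>I\<close> by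
  \<open>h\<^sub>i\<^sup>T M\<^sub>I h\<^sub>j\<close>. Along a spanning tree the \<open>h\<^sub>v\<close> can be chosen (as polynomials in the amplitudes of
  the tree edges) such that every tree edge becomes a multiple of the singlet, provided that
  \<open>det M\<^sub>I \<noteq> 0\<close>, which holds almost surely. The tree constraints then say that the state is symmetric,
  i.e. given by a sequence \<open>s\<^sub>0, \<dots>, s\<^sub>n\<close> indexed by the Hamming weight, and every further edge imposes
  a recurrence of order two on \<open>s\<close>. Almost surely its leading coefficient is nonzero, so that one
  such recurrence leaves two degrees of freedom, and two such recurrences have characteristic
  polynomials without common root and only the solution \<open>0\<close>. Both genericity claims follow from
  Fubini's theorem: for fixed \<open>\<phi>\<close> on the other edges, they exclude finitely many zeros of
  nontrivial linear forms in the amplitudes of the last edge.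
\<close>

section \<open>Null events for a uniform random unit vector and for families of independent
  ones\<close>

text \<open>The uniform distribution is the image of Lebesgue measure on the ball under
  \<open>sgn\<close>, so the event pulls back to \<open>sgn x \<in> S\<close>. The cone condition
  puts this preimage inside \<open>S\<close> itself, which has Lebesgue measure 0.\<close>

lemma AE_uniform_sphere_cone:
  fixes S :: "'a::euclidean_space set"
  assumes "negligible S" and [measurable]: "S \<in> sets borel"
    and cone: "\<And>x. sgn x \<in> S \<Longrightarrow> x \<in> S"
  shows "AE x in uniform_sphere. x \<notin> S"
proof -
  note [measurable] = borel_measurable_sgn_euclidean
  have "S \<in> null_sets lborel"
    using assms(1) by (simp add: negligible_iff_null_sets null_sets_completion_iff)
  then have "AE x in lborel. sgn x \<notin> S"
    using cone by (blast intro: eventually_mono[OF AE_not_in])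
  then have "AE x in uniform_measure lborel (cball 0 1). sgn x \<notin> S"
    by (intro AE_uniform_measureI) (auto elim: eventually_mono)
  moreover have "{x \<in> space borel. x \<notin> S} \<in> sets borel" by measurable
  ultimately show ?thesis
    unfolding uniform_sphere_def by (subst AE_distr_iff) simp_all
qed

text \<open>The real part of the form is the real inner product of \<open>y\<close> with the vector
  \<open>w\<close> of coefficients, so its zeros lie in a hyperplane through the origin, which is a
  negligible cone.\<close>

lemma AE_uniform_sphere_linear_form:
  fixes c :: "2 \<Rightarrow> 2 \<Rightarrow> complex"
  assumes "c \<noteq> (\<lambda>_ _. 0)"
  shows "AE y in uniform_sphere. (\<Sum>a\<in>UNIV. \<Sum>b\<in>UNIV. c a b * cnj (y $ (a, b))) \<noteq> 0"
proof -
  define w :: two_qubits where "w = (\<chi> p. c (fst p) (snd p))"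
  let ?S = "{y. w \<bullet> y = 0}"
  have w: "w \<noteq> 0"
    using assms by (auto simp: w_def vec_eq_iff fun_eq_iff)
  have Re: "Re (\<Sum>a\<in>UNIV. \<Sum>b\<in>UNIV. c a b * cnj (y $ (a, b))) = w \<bullet> y" for y
    by (simp add: w_def inner_vec_def inner_complex_def sum.cartesian_product case_prod_unfold)
  have "AE y in uniform_sphere. y \<notin> ?S"
  proof (rule AE_uniform_sphere_cone)
    show "negligible ?S" using w by (intro negligible_hyperplane) simp
    show "?S \<in> sets borel" by (intro borel_closed closed_hyperplane)
    show "x \<in> ?S" if "sgn x \<in> ?S" for x
      using that by (cases "x = 0") (auto simp: sgn_div_norm)
  qed
  then show ?thesis
  proof (rule eventually_mono)
    fix y assume "y \<notin> ?S"
    then have "Re (\<Sum>a\<in>UNIV. \<Sum>b\<in>UNIV. c a b * cnj (y $ (a, b))) \<noteq> 0"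
      unfolding Re by simp
    then show "(\<Sum>a\<in>UNIV. \<Sum>b\<in>UNIV. c a b * cnj (y $ (a, b))) \<noteq> 0"
      by (metis zero_complex.sel(1))
  qed
qed

lemma negligible_two_qubits_coord_0: "negligible {x :: two_qubits. x $ p = 0}"
proof -
  let ?w = "axis p 1 :: two_qubits"
  have "{x :: two_qubits. x $ p = 0} \<subseteq> {x. ?w \<bullet> x = 0}"
    by (auto simp: inner_axis')
  then show ?thesis
    by (rule negligible_subset[OF negligible_hyperplane, rotated]) (simp add: axis_eq_0_iff)
qed

text \<open>
  A singular matrix with nonzero corner is determined by its first row and the ratio of the rows,
  so the set of these matrices is the image of a hyperplane under a polynomial map.
\<close>

lemma AE_uniform_sphere_det:
  "AE y in (uniform_sphere :: two_qubits measure).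
     y $ (1, 1) * y $ (2, 2) - y $ (1, 2) * y $ (2, 1) \<noteq> 0"
proof -
  let ?S = "{y :: two_qubits. y $ (1, 1) * y $ (2, 2) - y $ (1, 2) * y $ (2, 1) = 0}"
  let ?Z = "\<lambda>p. {y :: two_qubits. y $ p = 0}"
  define f :: "2 \<times> 2 \<Rightarrow> two_qubits \<Rightarrow> complex" where
    "f p x = (if p = (2, 1) then x $ (2, 1) * x $ (1, 1)
              else if p = (2, 2) then x $ (2, 1) * x $ (1, 2) else x $ p)" for p x
  define F :: "two_qubits \<Rightarrow> two_qubits" where "F x = (\<chi> p. f p x)" for x
  have nth: "(\<lambda>x :: two_qubits. x $ p) differentiable (at x within S)" for p x S
    by (intro bounded_linear_imp_differentiable bounded_linear_vec_nth)
  have f: "f p differentiable (at x within S)" for p x S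
    unfolding f_def[abs_def] by (cases "p = (2,1)"; cases "p = (2,2)") (auto intro!: nth differentiable_mult)
  have "F differentiable (at x within S)" for x S
    by (subst differentiable_componentwise_within)
       (auto simp: Basis_vec_def inner_axis F_def intro!: differentiable_inner f)
  then have "negligible (F ` ?Z (2, 2))"
    by (intro negligible_differentiable_image_negligible negligible_two_qubits_coord_0)
       (auto simp: differentiable_on_def)
  moreover have "y \<in> F ` ?Z (2, 2)" if "y \<in> ?S" "y $ (1, 1) \<noteq> 0" for y
  proof -
    let ?x = "\<chi> p. if p = (2, 2) then 0 else if p = (2, 1) then y $ (2, 1) / y $ (1, 1) else y $ p"
    have "y $ p = f p ?x" for p
      using that by (auto simp: f_def field_simps)
    then have "y = F ?x" by (simp add: F_def vec_eq_iff)
    moreover have "?x \<in> ?Z (2, 2)" by simp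
    ultimately show ?thesis by blast
  qed
  then have "?S \<subseteq> F ` ?Z (2, 2) \<union> ?Z (1, 1)" by blast
  ultimately have "negligible ?S"
    by (blast intro: negligible_subset[OF negligible_Un[OF _ negligible_two_qubits_coord_0]])
  moreover have "closed ?S"
    by (intro closed_Collect_eq continuous_intros)
  moreover have "x \<in> ?S" if "sgn x \<in> ?S" for x
    using that by (cases "x = 0") (auto simp: sgn_div_norm scaleR_diff_right[symmetric])
  ultimately have "AE y in uniform_sphere. y \<notin> ?S"
    by (intro AE_uniform_sphere_cone) auto
  then show ?thesis by simp
qed

text \<open>Fubini: integrating the indicator of the exceptional set over coordinate
  \<open>i\<close> first gives 0 for every choice of the other coordinates. Genericity of a whole
  instance is thereby reduced to a claim about a single random vector with the rest frozen.\<close>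

lemma AE_PiM_fibre:
  assumes "finite I" "i \<in> I" "prob_space M"
    and meas: "{x \<in> space (PiM I (\<lambda>_. M)). P x} \<in> sets (PiM I (\<lambda>_. M))"
    and ae: "\<And>x. AE y in M. P (x(i := y))"
  shows "AE x in PiM I (\<lambda>_. M). P x"
proof -
  interpret prob_space M by fact
  interpret product_prob_space "\<lambda>_. M" by unfold_locales
  have I: "I = insert i (I - {i})" using assms by auto
  let ?f = "indicator {x \<in> space (PiM I (\<lambda>_. M)). \<not> P x} :: _ \<Rightarrow> ennreal"
  have N: "{x \<in> space (PiM I (\<lambda>_. M)). \<not> P x} \<in> sets (PiM I (\<lambda>_. M))"
    using meas by (rule sets.sets_Collect_neg)
  have "(\<integral>\<^sup>+x. ?f x \<partial>PiM I (\<lambda>_. M)) = (\<integral>\<^sup>+x. (\<integral>\<^sup>+y. ?f (x(i := y)) \<partial>M) \<partial>PiM (I - {i}) (\<lambda>_. M))"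
    using product_nn_integral_insert[of "I - {i}" i ?f] N assms(1,2) by (simp add: insert_absorb)
  also have "\<dots> = (\<integral>\<^sup>+x. 0 \<partial>PiM (I - {i}) (\<lambda>_. M))"
  proof (rule nn_integral_cong)
    fix x
    have "(\<integral>\<^sup>+y. ?f (x(i := y)) \<partial>M) = (\<integral>\<^sup>+y. 0 \<partial>M)"
      using ae[of x] by (intro nn_integral_cong_AE) (auto elim!: eventually_mono)
    then show "(\<integral>\<^sup>+y. ?f (x(i := y)) \<partial>M) = 0" by simp
  qed
  finally have "emeasure (PiM I (\<lambda>_. M)) {x \<in> space (PiM I (\<lambda>_. M)). \<not> P x} = 0"
    using N by simp
  then show ?thesis using N by (intro AE_I[where N="{x \<in> space (PiM I (\<lambda>_. M)). \<not> P x}"]) auto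
qed


section \<open>Kernel of the Hamiltonian as a system of edge constraints\<close>

type_synonym mat2 = "2 \<Rightarrow> 2 \<Rightarrow> complex"

text \<open>The contraction of \<open>\<psi>\<close> with a bilinear form on the qubits
  \<open>i\<close> and \<open>j\<close>. It is indexed by a full assignment \<open>z\<close>, whose
  values at \<open>i\<close> and \<open>j\<close> are overwritten.\<close>

definition edge_form :: "'v \<Rightarrow> 'v \<Rightarrow> mat2 \<Rightarrow> 'v::finite qubits \<Rightarrow> ('v \<Rightarrow> 2) \<Rightarrow> complex" where
  "edge_form i j M \<psi> z = (\<Sum>a\<in>UNIV. \<Sum>b\<in>UNIV. M a b * \<psi> $ (z(i := a, j := b)))"

definition edge_sat :: "'v \<Rightarrow> 'v \<Rightarrow> mat2 \<Rightarrow> 'v::finite qubits \<Rightarrow> bool" where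
  "edge_sat i j M \<psi> \<longleftrightarrow> (\<forall>z. edge_form i j M \<psi> z = 0)"

text \<open>The bra of \<open>\<phi>\<close>. With the conjugation absorbed here, a change of basis
  acts on these matrices by transposes rather than adjoints.\<close>

definition dual_mat :: "two_qubits \<Rightarrow> mat2" where
  "dual_mat \<phi> a b = cnj (\<phi> $ (a, b))"

lemma sum_UNIV_update_2:
  fixes F :: "('v::finite \<Rightarrow> 2) \<Rightarrow> 'a::{semiring_1}"
  shows "(\<Sum>z\<in>UNIV. \<Sum>a\<in>UNIV. F (z(v := a))) = 2 * (\<Sum>z\<in>UNIV. F z)"
proof -
  \<comment> \<open>Addition on the type \<open>2\<close> is modulo 2. Overwriting a bit is not
    injective, but adding a fixed \<open>c\<close> to it is a bijection of the assignments, so each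
    of the two values of \<open>c\<close> contributes the whole sum once.\<close>
  have shift: "(\<Sum>a\<in>UNIV. F (z(v := a))) = (\<Sum>c\<in>UNIV. F (z(v := z v + c)))" for z
    by (rule sum.reindex_bij_witness[where i="\<lambda>c. z v + c" and j="\<lambda>a. a - z v"]) simp_all
  have "(\<Sum>z\<in>UNIV. F (z(v := z v + c))) = (\<Sum>z\<in>UNIV. F z)" for c
    by (rule sum.reindex_bij_witness[where i="\<lambda>z. z(v := z v - c)" and j="\<lambda>z. z(v := z v + c)"]) simp_all
  then have "(\<Sum>c\<in>UNIV. \<Sum>z\<in>UNIV. F (z(v := z v + c))) = 2 * (\<Sum>z\<in>UNIV. F z)"
    by simp
  then show ?thesis
    unfolding shift by (subst sum.swap)
qed

lemma act_on_ketbra_mult: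
  fixes \<psi> :: "'v::finite qubits"
  assumes "i \<noteq> j"
  shows "(act_on (i, j) (ketbra \<phi>) *v \<psi>) $ x = \<phi> $ (x i, x j) * edge_form i j (dual_mat \<phi>) \<psi> x"
proof -
  have "(act_on (i, j) (ketbra \<phi>) *v \<psi>) $ x
      = (\<Sum>y\<in>UNIV. if \<forall>k. k \<notin> {i, j} \<longrightarrow> x k = y k
           then \<phi> $ (x i, x j) * cnj (\<phi> $ (y i, y j)) * \<psi> $ y else 0)"
    unfolding act_on_def ketbra_def matrix_vector_mult_def
    by (auto intro!: sum.cong)
  also have "\<dots> = (\<Sum>y\<in>{y. \<forall>k. k \<notin> {i, j} \<longrightarrow> x k = y k}. \<phi> $ (x i, x j) * cnj (\<phi> $ (y i, y j)) * \<psi> $ y)"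
    by (subst sum.inter_filter[symmetric]) auto
  also have "\<dots> = (\<Sum>(a, b)\<in>UNIV \<times> UNIV. \<phi> $ (x i, x j) * cnj (\<phi> $ (a, b)) * \<psi> $ (x(i := a, j := b)))"
  proof (rule sum.reindex_bij_witness[where i="\<lambda>(a, b). x(i := a, j := b)" and j="\<lambda>y. (y i, y j)"])
    show eq: "(case (y i, y j) of (a, b) \<Rightarrow> x(i := a, j := b)) = y"
      if "y \<in> {y. \<forall>k. k \<notin> {i, j} \<longrightarrow> x k = y k}" for y
      using that by (intro ext) simp
    show "(case (y i, y j) of (a, b) \<Rightarrow> \<phi> $ (x i, x j) * cnj (\<phi> $ (a, b)) * \<psi> $ (x(i := a, j := b)))
        = \<phi> $ (x i, x j) * cnj (\<phi> $ (y i, y j)) * \<psi> $ y"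
      if "y \<in> {y. \<forall>k. k \<notin> {i, j} \<longrightarrow> x k = y k}" for y
      using eq[OF that] by simp
  qed (use assms in \<open>simp_all add: case_prod_unfold\<close>)
  also have "\<dots> = \<phi> $ (x i, x j) * edge_form i j (dual_mat \<phi>) \<psi> x"
    by (simp only: sum.cartesian_product[symmetric] edge_form_def dual_mat_def sum_distrib_left mult.assoc)
  finally show ?thesis .
qed

lemma edge_form_update [simp]:
  assumes "i \<noteq> j"
  shows "edge_form i j M \<psi> (z(i := a)) = edge_form i j M \<psi> z"
    "edge_form i j M \<psi> (z(j := b)) = edge_form i j M \<psi> z"
  using assms by (simp_all add: edge_form_def fun_upd_twist)

text \<open>The expectation of \<open>ketbra \<phi>\<close> on the edge is the squared norm of the
  contraction with \<open>\<phi>\<close>. Summing over full assignments counts every assignment of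
  the other qubits four times, hence the factor 4.\<close>

lemma edge_energy:
  fixes \<psi> :: "'v::finite qubits"
  assumes "i \<noteq> j"
  shows "4 * (\<Sum>x\<in>UNIV. cnj (\<psi> $ x) * (act_on (i, j) (ketbra \<phi>) *v \<psi>) $ x)
    = of_real (\<Sum>x\<in>UNIV. (cmod (edge_form i j (dual_mat \<phi>) \<psi> x))\<^sup>2)"
proof -
  let ?L = "edge_form i j (dual_mat \<phi>) \<psi>"
  let ?F = "\<lambda>x. cnj (\<psi> $ x) * (\<phi> $ (x i, x j) * ?L x)"
  have "4 * (\<Sum>x\<in>UNIV. ?F x) = 2 * (\<Sum>x\<in>UNIV. \<Sum>a\<in>UNIV. ?F (x(i := a)))"
    by (subst sum_UNIV_update_2[of ?F]) simp
  also have "\<dots> = (\<Sum>x\<in>UNIV. \<Sum>b\<in>UNIV. \<Sum>a\<in>UNIV. ?F (x(j := b, i := a)))"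
    by (subst sum_UNIV_update_2[of "\<lambda>x. \<Sum>a\<in>UNIV. ?F (x(i := a))"]) (rule refl)
  also have "\<dots> = (\<Sum>x\<in>UNIV. cnj (?L x) * ?L x)"
  proof (rule sum.cong[OF refl])
    fix x
    have "(\<Sum>b\<in>UNIV. \<Sum>a\<in>UNIV. ?F (x(j := b, i := a)))
        = (\<Sum>b\<in>UNIV. \<Sum>a\<in>UNIV. cnj (dual_mat \<phi> a b * \<psi> $ (x(i := a, j := b))) * ?L x)"
      using assms by (intro sum.cong refl) (simp add: dual_mat_def fun_upd_twist[of i j])
    also have "\<dots> = cnj (?L x) * ?L x"
      by (subst sum.swap) (simp only: sum_distrib_right[symmetric] cnj_sum[symmetric] edge_form_def)
    finally show "(\<Sum>b\<in>UNIV. \<Sum>a\<in>UNIV. ?F (x(j := b, i := a))) = cnj (?L x) * ?L x" .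
  qed
  also have "\<dots> = of_real (\<Sum>x\<in>UNIV. (cmod (?L x))\<^sup>2)"
    by (simp add: complex_norm_square mult.commute del: of_real_power)
  finally show ?thesis using assms by (simp add: act_on_ketbra_mult)
qed

text \<open>A state killed by the sum has total energy 0, and by \<open>edge_energy\<close> this
  energy is a sum of nonnegative terms, so every contraction vanishes.\<close>

lemma op_kernel_qsat_hamiltonian:
  fixes E :: "'v::finite set set"
  assumes ne: "\<And>I. I \<in> E \<Longrightarrow> fst (ends I) \<noteq> snd (ends I)"
  shows "op_kernel (qsat_hamiltonian ends E \<phi>)
    = {\<psi>. \<forall>I\<in>E. edge_sat (fst (ends I)) (snd (ends I)) (dual_mat (\<phi> I)) \<psi>}"
proof (intro set_eqI iffI)
  fix \<psi> :: "'v qubits"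
  let ?P = "\<lambda>I. act_on (ends I) (ketbra (\<phi> I))"
  let ?L = "\<lambda>I. edge_form (fst (ends I)) (snd (ends I)) (dual_mat (\<phi> I)) \<psi>"
  have fin: "finite E" by simp
  have H: "qsat_hamiltonian ends E \<phi> *v \<psi> = (\<Sum>I\<in>E. ?P I *v \<psi>)"
    unfolding qsat_hamiltonian_def using fin
    by (induction E rule: finite_induct) (auto simp: matrix_vector_mult_add_rdistrib)
  {
    assume "\<psi> \<in> op_kernel (qsat_hamiltonian ends E \<phi>)"
    then have 0: "(\<Sum>I\<in>E. ?P I *v \<psi>) = 0" by (simp add: op_kernel_def H)
    define e where "e = (\<Sum>I\<in>E. \<Sum>x\<in>UNIV. (cmod (?L I x))\<^sup>2)"
    have "complex_of_real e = (\<Sum>I\<in>E. of_real (\<Sum>x\<in>UNIV. (cmod (?L I x))\<^sup>2))"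
      by (simp add: e_def)
    also have "\<dots> = (\<Sum>I\<in>E. 4 * (\<Sum>x\<in>UNIV. cnj (\<psi> $ x) * (?P I *v \<psi>) $ x))"
      by (intro sum.cong refl, subst edge_energy[symmetric]) (use ne in auto)
    also have "\<dots> = 4 * (\<Sum>x\<in>UNIV. cnj (\<psi> $ x) * (\<Sum>I\<in>E. ?P I *v \<psi>) $ x)"
      by (simp add: sum_distrib_left sum_component, subst sum.swap, rule refl)
    finally have "(\<Sum>I\<in>E. \<Sum>x\<in>UNIV. (cmod (?L I x))\<^sup>2) = 0"
      using 0 by (simp add: e_def[symmetric])
    then have "\<forall>I\<in>E. (\<Sum>x\<in>UNIV. (cmod (?L I x))\<^sup>2) = 0"
      by (subst (asm) sum_nonneg_eq_0_iff) (auto intro: sum_nonneg)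
    then have "\<forall>I\<in>E. \<forall>x. ?L I x = 0"
      by (subst (asm) sum_nonneg_eq_0_iff) auto
    then show "\<psi> \<in> {\<psi>. \<forall>I\<in>E. edge_sat (fst (ends I)) (snd (ends I)) (dual_mat (\<phi> I)) \<psi>}"
      by (simp add: edge_sat_def)
  next
    assume "\<psi> \<in> {\<psi>. \<forall>I\<in>E. edge_sat (fst (ends I)) (snd (ends I)) (dual_mat (\<phi> I)) \<psi>}"
    then have "?P I *v \<psi> = 0" if "I \<in> E" for I
      using that ne act_on_ketbra_mult[of "fst (ends I)" "snd (ends I)" "\<phi> I" \<psi>]
      by (simp add: vec_eq_iff edge_sat_def)
    then show "\<psi> \<in> op_kernel (qsat_hamiltonian ends E \<phi>)"
      by (simp add: op_kernel_def H)
  }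
qed

section \<open>Invertible changes of basis at single vertices\<close>

text \<open>In matrix notation, the transpose of \<open>g\<close> times \<open>M\<close> times
  \<open>h\<close>.\<close>

definition congr2 :: "mat2 \<Rightarrow> mat2 \<Rightarrow> mat2 \<Rightarrow> mat2" where
  "congr2 g M h = (\<lambda>c d. \<Sum>a\<in>UNIV. \<Sum>b\<in>UNIV. g a c * M a b * h b d)"

definition det2 :: "mat2 \<Rightarrow> complex" where
  "det2 M = M 1 1 * M 2 2 - M 1 2 * M 2 1"

definition id2 :: mat2 where "id2 a b = of_bool (a = b)"

definition site_op :: "'v \<Rightarrow> mat2 \<Rightarrow> 'v::finite qubits \<Rightarrow> 'v qubits" where
  "site_op v g \<psi> = (\<chi> x. \<Sum>a\<in>UNIV. g (x v) a * \<psi> $ (x(v := a)))"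

lemma congr2_id2 [simp]: "congr2 id2 M id2 = M"
proof (intro ext)
  fix a b show "congr2 id2 M id2 a b = M a b"
    using exhaust_2[of a] exhaust_2[of b] by (elim disjE) (simp_all add: congr2_def id2_def sum_2)
qed

lemma congr2_id2_id2 [simp]:
  "congr2 k (congr2 id2 M m) id2 = congr2 k M m"
  "congr2 id2 (congr2 k M id2) m = congr2 k M m"
proof -
  show "congr2 k (congr2 id2 M m) id2 = congr2 k M m"
  proof (intro ext)
    fix a b show "congr2 k (congr2 id2 M m) id2 a b = congr2 k M m a b"
      using exhaust_2[of b]
      by (elim disjE) (simp_all add: congr2_def id2_def sum_2 distrib_left mult.assoc)
  qed
  show "congr2 id2 (congr2 k M id2) m = congr2 k M m"
  proof (intro ext)
    fix a b show "congr2 id2 (congr2 k M id2) m a b = congr2 k M m a b"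
      using exhaust_2[of a]
      by (elim disjE) (simp_all add: congr2_def id2_def sum_2 distrib_right)
  qed
qed

lemma edge_form_site_op_1:
  assumes "i \<noteq> j"
  shows "edge_form i j M (site_op i g \<psi>) = edge_form i j (congr2 g M id2) \<psi>"
  using assms by (auto simp: fun_eq_iff edge_form_def site_op_def congr2_def id2_def sum_2 algebra_simps fun_upd_twist)

lemma edge_form_site_op_2:
  assumes "i \<noteq> j"
  shows "edge_form i j M (site_op j g \<psi>) = edge_form i j (congr2 id2 M g) \<psi>"
  using assms by (auto simp: fun_eq_iff edge_form_def site_op_def congr2_def id2_def sum_2 algebra_simps fun_upd_twist)

lemma edge_sat_site_op:
  assumes "i \<noteq> j"
  shows "edge_sat i j M (site_op i g \<psi>) = edge_sat i j (congr2 g M id2) \<psi>"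
    "edge_sat i j M (site_op j g \<psi>) = edge_sat i j (congr2 id2 M g) \<psi>"
  using assms by (simp_all add: edge_sat_def edge_form_site_op_1 edge_form_site_op_2)

lemma edge_form_site_op_3:
  assumes "v \<noteq> i" "v \<noteq> j"
  shows "edge_form i j M (site_op v g \<psi>) z = (\<Sum>a\<in>UNIV. g (z v) a * edge_form i j M \<psi> (z(v := a)))"
  using assms by (auto simp: edge_form_def site_op_def sum_2 algebra_simps fun_upd_twist)

lemma solve_2:
  assumes "det2 g \<noteq> 0" "\<And>r. (\<Sum>a\<in>UNIV. g r a * u a) = 0"
  shows "u a = 0"
proof -
  have 1: "g 1 1 * u 1 + g 1 2 * u 2 = 0" "g 2 1 * u 1 + g 2 2 * u 2 = 0"
    using assms(2)[of 1] assms(2)[of 2] by (simp_all add: sum_2)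
  have "det2 g * u 1 = 0" "det2 g * u 2 = 0"
    using 1 unfolding det2_def by algebra+
  then show ?thesis using assms(1) exhaust_2[of a] by auto
qed

text \<open>An operator on a qubit outside the edge commutes with the contraction: it mixes the
  values of \<open>edge_form\<close> for the two settings of \<open>v\<close> by \<open>g\<close>,
  and an invertible \<open>g\<close> sends only the zero pair to zero.\<close>

lemma edge_sat_site_op_other:
  assumes "v \<noteq> i" "v \<noteq> j" "det2 g \<noteq> 0"
  shows "edge_sat i j M (site_op v g \<psi>) \<longleftrightarrow> edge_sat i j M \<psi>"
proof
  assume L: "edge_sat i j M (site_op v g \<psi>)"
  show "edge_sat i j M \<psi>"
    unfolding edge_sat_def
  proof
    fix z
    have "(\<Sum>a\<in>UNIV. g r a * edge_form i j M \<psi> (z(v := a))) = 0" for r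
      using L[unfolded edge_sat_def, rule_format, of "z(v := r)"] assms
      by (simp add: edge_form_site_op_3)
    from solve_2[OF assms(3) this, of "z v"] show "edge_form i j M \<psi> z = 0" by simp
  qed
qed (use assms in \<open>simp add: edge_sat_def edge_form_site_op_3\<close>)

lemma linear_site_op: "Vector_Spaces.linear (*s) (*s) (site_op v g)"
  by unfold_locales (auto simp: site_op_def vec_eq_iff sum.distrib sum_distrib_left algebra_simps)

lemma inj_site_op:
  assumes "det2 g \<noteq> 0"
  shows "inj (site_op v g)"
proof -
  interpret Vector_Spaces.linear "(*s)" "(*s)" "site_op v g" by (rule linear_site_op)
  have "\<psi> = 0" if 0: "site_op v g \<psi> = 0" for \<psi>
  proof -
    have "\<psi> $ x = 0" for x
    proof -
      have "(\<Sum>a\<in>UNIV. g r a * \<psi> $ (x(v := a))) = 0" for r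
        using arg_cong[OF 0, of "\<lambda>w. w $ (x(v := r))"] by (simp add: site_op_def)
      from solve_2[OF assms this, of "x v"] show ?thesis by simp
    qed
    then show ?thesis by (simp add: vec_eq_iff)
  qed
  then show ?thesis by (auto simp: inj_iff_eq_0)
qed

text \<open>\<open>A\<close> is the tensor product of all \<open>h v\<close>, obtained by composing
  \<open>site_op\<close> vertex by vertex.\<close>

lemma exists_local_transformation:
  fixes h :: "'v::finite \<Rightarrow> mat2"
  assumes "\<And>v. det2 (h v) \<noteq> 0"
  shows "\<exists>A. Vector_Spaces.linear (*s) (*s) A \<and> inj A \<and>
    (\<forall>i j M \<psi>. i \<noteq> j \<longrightarrow> edge_sat i j M (A \<psi>) = edge_sat i j (congr2 (h i) M (h j)) (\<psi> :: 'v qubits))"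
proof -
  \<comment> \<open>The factors after treating the vertices in \<open>S\<close>. A vertex still to
    come carries \<open>id2\<close>, so including it replaces that identity by \<open>h v\<close> in
    the congruence.\<close>
  define g where "g S v = (if v \<in> S then h v else id2)" for S v
  have "finite S \<Longrightarrow> \<exists>A. Vector_Spaces.linear (*s) (*s) A \<and> inj A \<and>
    (\<forall>i j M \<psi>. i \<noteq> j \<longrightarrow> edge_sat i j M (A \<psi>) = edge_sat i j (congr2 (g S i) M (g S j)) (\<psi> :: 'v qubits))"
    for S
  proof (induction S rule: finite_induct)
    case empty
    have "Vector_Spaces.linear (*s) (*s) (\<lambda>\<psi> :: 'v qubits. \<psi>)"
      by (rule vec.linear_ident)
    then show ?case
      by (intro exI[of _ "\<lambda>\<psi>. \<psi>"]) (simp add: g_def)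
  next
    case (insert v S)
    then obtain A where A: "Vector_Spaces.linear (*s) (*s) A" "inj A"
      "\<And>i j M \<psi>. i \<noteq> j \<Longrightarrow> edge_sat i j M (A \<psi>) = edge_sat i j (congr2 (g S i) M (g S j)) (\<psi> :: 'v qubits)"
      by blast
    have gv: "g S v = id2" "g (insert v S) v = h v" and
      gn: "\<And>u. u \<noteq> v \<Longrightarrow> g (insert v S) u = g S u"
      using insert.hyps by (auto simp: g_def)
    have "edge_sat i j M ((A \<circ> site_op v (h v)) \<psi>)
        = edge_sat i j (congr2 (g (insert v S) i) M (g (insert v S) j)) \<psi>"
      if ij: "i \<noteq> j" for i j M \<psi>
    proof -
      consider "v = i" | "v = j" | "v \<noteq> i" "v \<noteq> j" by blast
      then show ?thesis
      proof cases
        case 1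
        then have "g (insert v S) j = g S j" using gn[of j] ij by auto
        with 1 ij gv show ?thesis
          unfolding o_apply A(3)[OF ij] by (simp add: edge_sat_site_op)
      next
        case 2
        then have "g (insert v S) i = g S i" using gn[of i] ij by auto
        with 2 ij gv show ?thesis
          unfolding o_apply A(3)[OF ij] by (simp add: edge_sat_site_op)
      next
        case 3
        then have "g (insert v S) i = g S i" "g (insert v S) j = g S j" using gn[of i] gn[of j] by auto
        with 3 assms show ?thesis
          unfolding o_apply A(3)[OF ij] by (simp add: edge_sat_site_op_other)
      qed
    qed
    moreover have "inj (A \<circ> site_op v (h v))"
      using A(2) inj_site_op[OF assms] by (rule inj_compose)
    moreover have "Vector_Spaces.linear (*s) (*s) (A \<circ> site_op v (h v))"
      using linear_site_op A(1) by (rule Vector_Spaces.linear_compose)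
    ultimately show ?case
      by blast
  qed
  from this[of UNIV] show ?thesis by (simp add: g_def)
qed


section \<open>Singlet constraints and symmetric states\<close>

definition swap_at :: "'v \<Rightarrow> 'v \<Rightarrow> ('v \<Rightarrow> 2) \<Rightarrow> 'v \<Rightarrow> 2" where
  "swap_at i j z = z(i := z j, j := z i)"

definition weight :: "('v::finite \<Rightarrow> 2) \<Rightarrow> nat" where
  "weight z = card {v. z v = 2}"

text \<open>The symmetric state with coefficients \<open>s 0\<close>, \<open>s 1\<close>, ... on the
  unnormalised Dicke states.\<close>

definition weight_vec :: "(nat \<Rightarrow> complex) \<Rightarrow> 'v::finite qubits" where
  "weight_vec s = (\<chi> z. s (weight z))"

text \<open>The nonzero multiples of the singlet.\<close>

definition antisym2 :: "mat2 \<Rightarrow> bool" where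
  "antisym2 M \<longleftrightarrow> M 1 1 = 0 \<and> M 2 2 = 0 \<and> M 1 2 + M 2 1 = 0 \<and> M 1 2 \<noteq> 0"

text \<open>A singlet only compares the two settings of the edge with unequal bits, which the swap
  exchanges; settings with equal bits are fixed by the swap.\<close>

lemma edge_sat_antisym2:
  fixes \<psi> :: "'v::finite qubits"
  assumes "i \<noteq> j" "antisym2 M"
  shows "edge_sat i j M \<psi> \<longleftrightarrow> (\<forall>z. \<psi> $ swap_at i j z = \<psi> $ z)"
proof -
  have "M 2 1 = - M 1 2" using assms(2) by (simp add: antisym2_def add_eq_0_iff)
  then have form: "edge_form i j M \<psi> z = M 1 2 * (\<psi> $ (z(i := 1, j := 2)) - \<psi> $ (z(i := 2, j := 1)))" for z
    using assms(2) by (simp add: edge_form_def antisym2_def sum_2 algebra_simps)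
  show ?thesis
  proof
    assume sat: "edge_sat i j M \<psi>"
    have eq: "\<psi> $ (z(i := 1, j := 2)) = \<psi> $ (z(i := 2, j := 1))" for z
      using sat assms(2) by (simp add: edge_sat_def form antisym2_def)
    show "\<forall>z. \<psi> $ swap_at i j z = \<psi> $ z"
    proof
      fix z :: "'v \<Rightarrow> 2"
      consider "z i = z j" | "z i = 1" "z j = 2" | "z i = 2" "z j = 1"
        using exhaust_2[of "z i"] exhaust_2[of "z j"] by fastforce
      then show "\<psi> $ swap_at i j z = \<psi> $ z"
      proof cases
        case 1
        then have "swap_at i j z = z" by (simp add: swap_at_def fun_upd_idem)
        then show ?thesis by simp
      next
        case 2
        then have "z(i := 1, j := 2) = z" by (simp add: fun_upd_idem)
        then show ?thesis using eq[of z] 2 by (simp add: swap_at_def)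
      next
        case 3
        then have "z(i := 2, j := 1) = z" by (simp add: fun_upd_idem)
        then show ?thesis using eq[of z] 3 by (simp add: swap_at_def)
      qed
    qed
  next
    assume sw: "\<forall>z. \<psi> $ swap_at i j z = \<psi> $ z"
    have "edge_form i j M \<psi> z = 0" for z
    proof -
      have "swap_at i j (z(i := 1, j := 2)) = z(i := 2, j := 1)"
        using assms(1) by (simp add: swap_at_def fun_upd_twist)
      then have "\<psi> $ (z(i := 1, j := 2)) = \<psi> $ (z(i := 2, j := 1))"
        using sw[rule_format, of "z(i := 1, j := 2)"] by simp
      then show ?thesis by (simp add: form)
    qed
    then show "edge_sat i j M \<psi>" by (simp add: edge_sat_def)
  qed
qed

lemma swap_at_same [simp]: "swap_at i i z = z"
  by (simp add: swap_at_def)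

text \<open>Transpositions propagate along a path: the swap of \<open>i\<close> and \<open>k\<close>
  is the swap of \<open>j\<close> and \<open>k\<close> conjugated by the swap of \<open>i\<close>
  and \<open>j\<close>.\<close>

lemma swap_at_invariant_rtrancl:
  assumes "(i, j) \<in> r\<^sup>*" and "\<And>a b z. (a, b) \<in> r \<Longrightarrow> F (swap_at a b z) = F z"
  shows "F (swap_at i j z) = F z"
  using assms(1)
proof (induction arbitrary: z rule: rtrancl_induct)
  case base
  show ?case by simp
next
  case (step j k)
  show ?case
  proof (cases "i = k \<or> i = j \<or> j = k")
    case True
    then show ?thesis using step.IH assms(2)[OF step(2)] by auto
  next
    case False
    then have "swap_at i k z = swap_at i j (swap_at j k (swap_at i j z))"
      by (intro ext) (auto simp: swap_at_def)
    then show ?thesis using step.IH assms(2)[OF step(2)] by simp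
  qed
qed

text \<open>Induction on the number of positions where \<open>x\<close> has a 2 and \<open>y\<close>
  does not. Equal weight provides a position of the opposite kind, and swapping the two decreases
  that number.\<close>

lemma swap_at_invariant_weight:
  fixes F :: "('v::finite \<Rightarrow> 2) \<Rightarrow> 'a"
  assumes sw: "\<And>i j z. F (swap_at i j z) = F z" and "weight x = weight y"
  shows "F x = F y"
  using assms(2)
proof (induction "card ({v. x v = 2} - {v. y v = 2})" arbitrary: x rule: less_induct)
  case less
  let ?X = "{v. x v = 2}" and ?Y = "{v. y v = 2}"
  show ?case
  proof (cases "?X = ?Y")
    case True
    have "x = y"
    proof
      fix v
      have "x v = 2 \<longleftrightarrow> y v = 2" using True by blast
      then show "x v = y v" using exhaust_2[of "x v"] exhaust_2[of "y v"] by metis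
    qed
    then show ?thesis by simp
  next
    case False
    have card: "card ?X = card ?Y" using less.prems by (simp add: weight_def)
    then have "\<not> ?X \<subseteq> ?Y" "\<not> ?Y \<subseteq> ?X"
      using False card_subset_eq[of ?Y ?X] card_subset_eq[of ?X ?Y] by auto
    then obtain i j where ij: "x i = 2" "y i \<noteq> 2" "y j = 2" "x j \<noteq> 2" by blast
    let ?x = "swap_at i j x"
    have X': "{v. ?x v = 2} = insert j (?X - {i})"
      using ij by (auto simp: swap_at_def)
    have "insert j (?X - {i}) - ?Y = (?X - ?Y) - {i}"
      using ij by auto
    then have "card ({v. ?x v = 2} - ?Y) < card (?X - ?Y)"
      unfolding X' using ij by (metis (mono_tags, lifting) DiffI card_Diff1_less finite mem_Collect_eq)
    moreover have "weight ?x = weight y"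
    proof -
      have "card (insert j (?X - {i})) = Suc (card (?X - {i}))"
        using ij by (intro card_insert_disjoint) auto
      also have "\<dots> = card ?X"
        using ij by (intro card_Suc_Diff1) auto
      finally show ?thesis using card by (simp add: weight_def X')
    qed
    ultimately have "F ?x = F y" by (rule less.hyps)
    then show ?thesis by (simp add: sw)
  qed
qed

lemma weight_le: "weight (z :: 'v::finite \<Rightarrow> 2) \<le> CARD('v)"
  by (simp add: weight_def card_mono)

lemma weight_update_2:
  fixes z :: "'v::finite \<Rightarrow> 2"
  assumes "i \<noteq> j"
  shows "weight (z(i := a, j := b)) = card ({v. z v = 2} - {i, j}) + of_bool (a = 2) + of_bool (b = 2)"
proof -
  let ?R = "{v. z v = 2} - {i, j}"
  have "{v. (z(i := a, j := b)) v = 2} = ?R \<union> (if a = 2 then {i} else {}) \<union> (if b = 2 then {j} else {})"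
    using assms by auto
  then have "weight (z(i := a, j := b)) = card (?R \<union> (if a = 2 then {i} else {}) \<union> (if b = 2 then {j} else {}))"
    by (simp only: weight_def)
  also have "\<dots> = card ?R + of_bool (a = 2) + of_bool (b = 2)"
    using assms by (subst card_Un_disjoint; (subst card_Un_disjoint)?; simp)
  finally show ?thesis .
qed

text \<open>Both settings of an edge with unequal bits add one to the weight, so on symmetric states
  the off-diagonal entries act through their sum.\<close>

definition recur :: "mat2 \<Rightarrow> (nat \<Rightarrow> complex) \<Rightarrow> nat \<Rightarrow> complex" where
  "recur M s k = M 1 1 * s k + (M 1 2 + M 2 1) * s (k + 1) + M 2 2 * s (k + 2)"

text \<open>On a symmetric state the contraction depends only on the number \<open>k\<close> of 2s
  outside the edge, and every \<open>k\<close> up to \<open>CARD('v) - 2\<close> occurs. The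
  condition no longer refers to the position of the edge.\<close>

lemma edge_sat_weight_vec:
  assumes "i \<noteq> j"
  shows "edge_sat i j M (weight_vec s :: 'v::finite qubits) \<longleftrightarrow> (\<forall>k. k + 2 \<le> CARD('v) \<longrightarrow> recur M s k = 0)"
proof -
  let ?k = "\<lambda>z. card ({v. z v = 2} - {i, j})"
  have form: "edge_form i j M (weight_vec s :: 'v qubits) z = recur M s (?k z)" for z
    using weight_update_2[OF assms, of z]
    by (simp add: edge_form_def weight_vec_def recur_def sum_2 algebra_simps)
  have le: "?k z + 2 \<le> CARD('v)" for z :: "'v \<Rightarrow> 2"
  proof -
    have "?k z \<le> card (UNIV - {i, j})" by (intro card_mono) auto
    also have "\<dots> = CARD('v) - 2" using assms by (subst card_Diff_subset) auto
    finally have "?k z \<le> CARD('v) - 2" .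
    moreover have "2 \<le> CARD('v)" using assms card_mono[of UNIV "{i, j}"] by simp
    ultimately show ?thesis by linarith
  qed
  show ?thesis
  proof
    assume sat: "edge_sat i j M (weight_vec s :: 'v qubits)"
    show "\<forall>k. k + 2 \<le> CARD('v) \<longrightarrow> recur M s k = 0"
    proof (intro allI impI)
      fix k assume "k + 2 \<le> CARD('v)"
      then have "k \<le> card (UNIV - {i, j})" using assms by (subst card_Diff_subset) auto
      then obtain X where X: "X \<subseteq> UNIV - {i, j}" "card X = k"
        by (metis obtain_subset_with_card_n)
      let ?z = "\<lambda>v. if v \<in> X then 2 else 1 :: 2"
      have "{v. ?z v = 2} - {i, j} = X" using X by auto
      then show "recur M s k = 0"
        using sat form[of ?z] X by (simp add: edge_sat_def)
    qed
  next
    assume "\<forall>k. k + 2 \<le> CARD('v) \<longrightarrow> recur M s k = 0"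
    then show "edge_sat i j M (weight_vec s :: 'v qubits)"
      using le by (simp add: edge_sat_def form)
  qed
qed

lemma exists_weight:
  assumes "k \<le> CARD('v)"
  shows "\<exists>z :: 'v::finite \<Rightarrow> 2. weight z = k"
proof -
  obtain X :: "'v set" where X: "card X = k"
    using assms by (metis obtain_subset_with_card_n)
  have "weight (\<lambda>v. if v \<in> X then 2 else 1) = card X" by (simp add: weight_def)
  then show ?thesis using X by blast
qed

text \<open>Swaps along the edges of a connected graph yield all swaps, and invariance under these
  leaves one amplitude per weight. Conversely, all coefficients of the recurrence of a singlet are
  0.\<close>

lemma edge_sat_connected_iff:
  fixes \<psi> :: "'v::finite qubits"
  assumes conn: "\<And>u v. (u, v) \<in> {(a, b). {a, b} \<in> T}\<^sup>*"
    and ends: "\<And>I. I \<in> T \<Longrightarrow> {fst (ends I), snd (ends I)} = I" "\<And>I. I \<in> T \<Longrightarrow> fst (ends I) \<noteq> snd (ends I)"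
    and M: "\<And>I. I \<in> T \<Longrightarrow> antisym2 (M I)"
  shows "(\<forall>I\<in>T. edge_sat (fst (ends I)) (snd (ends I)) (M I) \<psi>) \<longleftrightarrow> \<psi> \<in> range weight_vec"
proof
  assume sat: "\<forall>I\<in>T. edge_sat (fst (ends I)) (snd (ends I)) (M I) \<psi>"
  have edge: "\<psi> $ swap_at a b z = \<psi> $ z" if "{a, b} \<in> T" for a b z
  proof -
    have "\<psi> $ swap_at (fst (ends {a, b})) (snd (ends {a, b})) z = \<psi> $ z"
      using sat that edge_sat_antisym2[OF ends(2) M, OF that that] by blast
    moreover have "fst (ends {a, b}) = a \<and> snd (ends {a, b}) = b \<or> fst (ends {a, b}) = b \<and> snd (ends {a, b}) = a"
      using ends(1)[OF that] by (simp add: doubleton_eq_iff)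
    moreover have "swap_at b a z = swap_at a b z"
      by (intro ext) (simp add: swap_at_def)
    ultimately show ?thesis by auto
  qed
  have "\<psi> $ swap_at i j z = \<psi> $ z" for i j z
    using conn[of i j] by (rule swap_at_invariant_rtrancl) (use edge in blast)
  then have inv: "\<psi> $ x = \<psi> $ y" if "weight x = weight y" for x y
    using that by (rule swap_at_invariant_weight)
  have "\<psi> $ (SOME y. weight y = weight x) = \<psi> $ x" for x
    by (rule inv, rule someI[of "\<lambda>y. weight y = weight x"]) (rule refl)
  \<comment> \<open>\<open>SOME\<close> picks a representative of each weight. For \<open>k\<close>
    above the number of vertices the choice is arbitrary, but no assignment has that weight.\<close>
  then have "\<psi> = weight_vec (\<lambda>k. \<psi> $ (SOME y. weight y = k))"
    by (simp add: weight_vec_def vec_eq_iff)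
  then show "\<psi> \<in> range weight_vec" by blast
next
  assume "\<psi> \<in> range weight_vec"
  then obtain s where "\<psi> = weight_vec s" by blast
  then show "\<forall>I\<in>T. edge_sat (fst (ends I)) (snd (ends I)) (M I) \<psi>"
    using M by (simp add: edge_sat_weight_vec[OF ends(2)] recur_def antisym2_def)
qed

section \<open>Dimensions of the solution spaces of recurrences\<close>

text \<open>The coordinates at the points \<open>p k\<close> determine the elements of
  \<open>V\<close>, and the \<open>e k\<close> are dual to them. Subtracting from \<open>x\<close>
  the combination with coefficients \<open>x $ p k\<close> makes these coordinates vanish, so the
  \<open>e k\<close> form a basis.\<close>

lemma dim_eq_card_dual_points:
  fixes V :: "(complex ^ 'n::finite) set"
  assumes V: "vec.subspace V" and fin: "finite K"
    and e: "\<And>k. k \<in> K \<Longrightarrow> e k \<in> V"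
    and dual: "\<And>k l. k \<in> K \<Longrightarrow> l \<in> K \<Longrightarrow> e k $ p l = of_bool (k = l)"
    and inj: "\<And>x. x \<in> V \<Longrightarrow> (\<And>k. k \<in> K \<Longrightarrow> x $ p k = 0) \<Longrightarrow> x = 0"
  shows "vec.dim V = card K"
proof -
  have eval: "(\<Sum>k\<in>K. c k *s e k) $ p l = c l" if "l \<in> K" for c l
  proof -
    have "(\<Sum>k\<in>K. c k *s e k) $ p l = (\<Sum>k\<in>K. if k = l then c k else 0)"
      using dual that by (simp add: sum_component, intro sum.cong) auto
    then show ?thesis using fin that by simp
  qed
  have inj_e: "inj_on e K"
  proof (rule inj_onI)
    fix k l assume "k \<in> K" "l \<in> K" "e k = e l"
    then show "k = l" using dual[of k l] dual[of l l] by (cases "k = l") auto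
  qed
  have "vec.dim V = card (e ` K)"
  proof (rule vec.basis_card_eq_dim[symmetric])
    show "e ` K \<subseteq> V" using e by blast
    show "V \<subseteq> vec.span (e ` K)"
    proof
      fix x assume x: "x \<in> V"
      let ?y = "\<Sum>k\<in>K. x $ p k *s e k"
      have "?y \<in> V" using V e by (intro vec.subspace_sum vec.subspace_scale) auto
      then have "x - ?y = 0" using x V eval by (intro inj vec.subspace_diff) auto
      moreover have "?y \<in> vec.span (e ` K)"
        by (intro vec.span_sum vec.span_scale vec.span_base) auto
      ultimately show "x \<in> vec.span (e ` K)" by simp
    qed
    show "vec.independent (e ` K)"
    proof (rule vec.independent_if_scalars_zero)
      show "finite (e ` K)" using fin by simp
      fix f x assume 0: "(\<Sum>y\<in>e ` K. f y *s y) = 0" and "x \<in> e ` K"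
      then obtain l where l: "l \<in> K" "x = e l" by blast
      have "(\<Sum>k\<in>K. f (e k) *s e k) = 0" using 0 inj_e by (simp add: sum.reindex)
      with eval[OF l(1), of "\<lambda>k. f (e k)"] l show "f x = 0" by simp
    qed
  qed
  then show ?thesis by (simp add: card_image[OF inj_e])
qed

definition rec_kernel :: "mat2 set \<Rightarrow> 'v::finite qubits set" where
  "rec_kernel Q = {weight_vec s | s. \<forall>M\<in>Q. \<forall>k. k + 2 \<le> CARD('v) \<longrightarrow> recur M s k = 0}"

lemma weight_vec_eq_0_iff:
  "(weight_vec s :: 'v::finite qubits) = 0 \<longleftrightarrow> (\<forall>k\<le>CARD('v). s k = 0)"
proof
  assume 0: "(weight_vec s :: 'v qubits) = 0"
  show "\<forall>k\<le>CARD('v). s k = 0"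
  proof (intro allI impI)
    fix k assume "k \<le> CARD('v)"
    then obtain z :: "'v \<Rightarrow> 2" where "weight z = k" using exists_weight by blast
    then show "s k = 0" using arg_cong[OF 0, of "\<lambda>w. w $ z"] by (simp add: weight_vec_def)
  qed
qed (simp add: weight_vec_def vec_eq_iff weight_le)

lemma subspace_rec_kernel: "vec.subspace (rec_kernel Q :: 'v::finite qubits set)"
proof (rule vec.subspaceI)
  show "0 \<in> (rec_kernel Q :: 'v qubits set)"
    unfolding rec_kernel_def by (intro CollectI exI[of _ "\<lambda>_. 0"]) (simp add: weight_vec_eq_0_iff recur_def eq_commute[of 0])
  fix x y :: "'v qubits" and c :: complex
  assume "x \<in> rec_kernel Q"
  then obtain s where s: "x = weight_vec s" "\<And>M k. M \<in> Q \<Longrightarrow> k + 2 \<le> CARD('v) \<Longrightarrow> recur M s k = 0"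
    by (auto simp: rec_kernel_def)
  have "recur M (\<lambda>k. c * s k) k = c * recur M s k" for M k
    by (simp add: recur_def algebra_simps)
  moreover have "c *s x = weight_vec (\<lambda>k. c * s k)"
    using s by (simp add: weight_vec_def vec_eq_iff)
  ultimately show "c *s x \<in> rec_kernel Q"
    unfolding rec_kernel_def using s by (intro CollectI exI[of _ "\<lambda>k. c * s k"]) simp
  assume "y \<in> rec_kernel Q"
  then obtain t where t: "y = weight_vec t" "\<And>M k. M \<in> Q \<Longrightarrow> k + 2 \<le> CARD('v) \<Longrightarrow> recur M t k = 0"
    by (auto simp: rec_kernel_def)
  have "recur M (\<lambda>k. s k + t k) k = recur M s k + recur M t k" for M k
    by (simp add: recur_def algebra_simps)
  moreover have "x + y = weight_vec (\<lambda>k. s k + t k)"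
    using s t by (simp add: weight_vec_def vec_eq_iff)
  ultimately show "x + y \<in> rec_kernel Q"
    unfolding rec_kernel_def using s t by (intro CollectI exI[of _ "\<lambda>k. s k + t k"]) simp
qed

lemma dim_rec_kernel_empty: "vec.dim (rec_kernel {} :: 'v::finite qubits set) = CARD('v) + 1"
proof -
  obtain p :: "nat \<Rightarrow> 'v \<Rightarrow> 2" where p: "\<And>k. k \<le> CARD('v) \<Longrightarrow> weight (p k) = k"
    using exists_weight[where 'v='v] by metis
  have "vec.dim (rec_kernel {} :: 'v qubits set) = card {..CARD('v)}"
  proof (rule dim_eq_card_dual_points[where p=p and e="\<lambda>k. weight_vec (\<lambda>m. of_bool (k = m))"])
    fix x :: "'v qubits"
    assume x: "x \<in> rec_kernel {}" and 0: "\<And>k. k \<in> {..CARD('v)} \<Longrightarrow> x $ p k = 0"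
    then obtain s where "x = weight_vec s" by (auto simp: rec_kernel_def)
    with 0 p show "x = 0" by (simp add: weight_vec_eq_0_iff) (simp add: weight_vec_def)
  next
    show "vec.subspace (rec_kernel {} :: 'v qubits set)" by (rule subspace_rec_kernel)
    show "(weight_vec (\<lambda>m. of_bool (k = m)) :: 'v qubits) $ p l = of_bool (k = l)"
      if "l \<in> {..CARD('v)}" for k l
      using that by (simp add: weight_vec_def p)
  qed (auto simp: rec_kernel_def)
  then show ?thesis by simp
qed

lemma recur_solution:
  assumes "M 2 2 \<noteq> 0"
  shows "\<exists>s. s 0 = a \<and> s 1 = b \<and> (\<forall>k. recur M s k = 0)"
proof -
  \<comment> \<open>\<open>f\<close> moves the pair of consecutive terms one index forward.\<close>
  define f where "f = (\<lambda>(x, y). (y, - (M 1 1 * x + (M 1 2 + M 2 1) * y) / M 2 2))"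
  define s where "s k = fst ((f ^^ k) (a, b))" for k
  have 1: "s (k + 1) = snd ((f ^^ k) (a, b))" for k
    by (simp add: s_def f_def case_prod_unfold)
  have 2: "s (k + 2) = - (M 1 1 * s k + (M 1 2 + M 2 1) * s (k + 1)) / M 2 2" for k
    unfolding 1 using 1[of "k + 1"] by (simp add: s_def f_def case_prod_unfold)
  have "recur M s k = 0" for k
    unfolding recur_def 2 using assms by (simp add: field_simps)
  moreover have "s 0 = a" "s 1 = b" using 1[of 0] by (simp_all add: s_def)
  ultimately show ?thesis by blast
qed

lemma recur_unique:
  assumes "M 2 2 \<noteq> 0" "s 0 = 0" "s 1 = 0" "\<And>k. k + 2 \<le> n \<Longrightarrow> recur M s k = 0"
  shows "k \<le> n \<Longrightarrow> s k = 0"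
proof (induction k rule: less_induct)
  case (less k)
  consider "k = 0" | "k = 1" | m where "k = m + 2"
    by (metis One_nat_def add_2_eq_Suc' not0_implies_Suc)
  then show ?case
  proof cases
    case (3 m)
    then have "recur M s m = 0" "s m = 0" "s (m + 1) = 0" using less assms(4)[of m] by simp_all
    then show ?thesis using 3 assms(1) by (simp add: recur_def)
  qed (use assms in auto)
qed

text \<open>The amplitudes at weights 0 and 1 can be prescribed freely and determine the solution;
  both weights occur because there is at least one vertex.\<close>

lemma dim_rec_kernel_single:
  assumes "M 2 2 \<noteq> 0"
  shows "vec.dim (rec_kernel {M} :: 'v::finite qubits set) = 2"
proof -
  have 1: "CARD('v) \<ge> 1" by (simp add: Suc_leI)
  then obtain p :: "nat \<Rightarrow> 'v \<Rightarrow> 2" where p: "\<And>k. k \<le> 1 \<Longrightarrow> weight (p k) = k"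
    using exists_weight[where 'v='v] by (metis le_trans)
  have "\<exists>s. s 0 = of_bool (k = 0) \<and> s 1 = of_bool (k = 1) \<and> (\<forall>l. recur M s l = 0)" for k :: nat
    using recur_solution[where M=M, OF assms] by blast
  then obtain s where s: "\<And>k::nat. s k 0 = of_bool (k = 0)" "\<And>k. s k 1 = of_bool (k = 1)" "\<And>k l. recur M (s k) l = 0"
    by metis
  have "vec.dim (rec_kernel {M} :: 'v qubits set) = card {0, 1 :: nat}"
  proof (rule dim_eq_card_dual_points[where p=p and e="\<lambda>k. weight_vec (s k)"])
    show "vec.subspace (rec_kernel {M} :: 'v qubits set)" by (rule subspace_rec_kernel)
    show "weight_vec (s k) \<in> (rec_kernel {M} :: 'v qubits set)" for k
      using s(3) by (auto simp: rec_kernel_def)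
    show "(weight_vec (s k) :: 'v qubits) $ p l = of_bool (k = l)" if "k \<in> {0, 1}" "l \<in> {0, 1}" for k l
      using that p[of l] s by (auto simp: weight_vec_def)
    fix x :: "'v qubits"
    assume x: "x \<in> rec_kernel {M}" and 0: "\<And>k. k \<in> {0, 1} \<Longrightarrow> x $ p k = 0"
    then obtain t where t: "x = weight_vec t" "\<And>k. k + 2 \<le> CARD('v) \<Longrightarrow> recur M t k = 0"
      by (auto simp: rec_kernel_def)
    have "t 0 = 0" "t 1 = 0" using 0[of 0] 0[of 1] p[of 0] p[of 1] t by (simp_all add: weight_vec_def)
    then show "x = 0" using recur_unique[where M=M and s=t, OF assms _ _ t(2)] t(1) by (simp add: weight_vec_eq_0_iff)
  qed simp
  then show ?thesis by simp
qed

text \<open>The resultant of \<open>a\<^sub>0 + a\<^sub>1 X + a\<^sub>2 X\<^sup>2\<close> and \<open>b\<^sub>0 + b\<^sub>1 X + b\<^sub>2 X\<^sup>2\<close> in Bezout form.\<close>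

definition resultant2 :: "mat2 \<Rightarrow> mat2 \<Rightarrow> complex" where
  "resultant2 M N =
    (M 1 1 * N 2 2 - M 2 2 * N 1 1)\<^sup>2
    - (M 1 1 * (N 1 2 + N 2 1) - (M 1 2 + M 2 1) * N 1 1) * ((M 1 2 + M 2 1) * N 2 2 - M 2 2 * (N 1 2 + N 2 1))"

text \<open>The four equations form the Sylvester system of the two quadratics in the unknowns
  \<open>s 0\<close>, ..., \<open>s 3\<close>, whose determinant is the resultant up to
  sign.\<close>

lemma recur_pair_zero:
  assumes R: "resultant2 M N \<noteq> 0"
    and "recur M s 0 = 0" "recur M s 1 = 0" "recur N s 0 = 0" "recur N s 1 = 0"
  shows "s 0 = 0" "s 1 = 0" "s 2 = 0" "s 3 = 0"
proof -
  define a0 a1 a2 b0 b1 b2 where ab: "a0 = M 1 1" "a1 = M 1 2 + M 2 1" "a2 = M 2 2"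
    "b0 = N 1 1" "b1 = N 1 2 + N 2 1" "b2 = N 2 2"
  define A B C where ABC: "A = a0 * b1 - a1 * b0" "B = a0 * b2 - a2 * b0" "C = a1 * b2 - a2 * b1"
  have r: "B * B - A * C \<noteq> 0"
    using R by (simp add: resultant2_def ab ABC power2_eq_square)
  have eqs: "a0 * s 0 + a1 * s 1 + a2 * s 2 = 0" "a0 * s 1 + a1 * s 2 + a2 * s 3 = 0"
    "b0 * s 0 + b1 * s 1 + b2 * s 2 = 0" "b0 * s 1 + b1 * s 2 + b2 * s 3 = 0"
    using assms(2-5) by (simp_all add: recur_def ab eval_nat_numeral)
  \<comment> \<open>The first two combinations eliminate \<open>s 0\<close> from the equations at
    index 0 and \<open>s 3\<close> from those at index 1. They are a system for \<open>s 1\<close>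
    and \<open>s 2\<close> whose determinant is the resultant up to sign.\<close>
  have 0: "A * s 1 + B * s 2 = 0" "B * s 1 + C * s 2 = 0" "A * s 2 + B * s 3 = 0" "B * s 0 + C * s 1 = 0"
    unfolding ABC using eqs by algebra+
  have "(B * B - A * C) * s 1 = 0" "(B * B - A * C) * s 2 = 0"
    using 0 by algebra+
  with r show s12: "s 1 = 0" "s 2 = 0" by auto
  show "s 0 = 0"
  proof (rule ccontr)
    assume "s 0 \<noteq> 0"
    then have "a0 = 0" "b0 = 0" using eqs s12 by auto
    then show False using r by (simp add: ABC)
  qed
  show "s 3 = 0"
  proof (rule ccontr)
    assume "s 3 \<noteq> 0"
    then have "a2 = 0" "b2 = 0" using eqs s12 by auto
    then show False using r by (simp add: ABC)
  qed
qed

text \<open>Both recurrences at two consecutive indices kill a window of four consecutive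
  amplitudes. With at least three vertices such windows cover all weights; the last one starts at
  \<open>CARD('v) - 3\<close>.\<close>

lemma rec_kernel_trivial:
  assumes "resultant2 M N \<noteq> 0" "M \<in> Q" "N \<in> Q" "CARD('v) \<ge> 3"
  shows "rec_kernel Q = {0 :: 'v::finite qubits}"
proof (intro equalityI subsetI)
  fix x :: "'v qubits" assume "x \<in> rec_kernel Q"
  then obtain s where s: "x = weight_vec s" "\<And>M k. M \<in> Q \<Longrightarrow> k + 2 \<le> CARD('v) \<Longrightarrow> recur M s k = 0"
    by (auto simp: rec_kernel_def)
  have shift: "recur L (\<lambda>m. s (l + m)) k = recur L s (l + k)" for L l k
    by (simp add: recur_def add.assoc)
  have window: "s (l + m) = 0" if "l + 3 \<le> CARD('v)" "m \<in> {0, 1, 2, 3}" for l m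
    using recur_pair_zero[OF assms(1), of "\<lambda>m. s (l + m)"] that s(2) assms(2,3) by (auto simp: shift)
  have "s k = 0" if "k \<le> CARD('v)" for k
  proof (cases "k + 3 \<le> CARD('v)")
    case True
    then show ?thesis using window[of k 0] by simp
  next
    case False
    define l where "l = CARD('v) - 3"
    have l: "l + 3 = CARD('v)" using assms(4) by (simp add: l_def)
    then have "l \<le> k" "k - l \<in> {0, 1, 2, 3}" using False that by auto
    then show ?thesis using window[of l "k - l"] l by simp
  qed
  then show "x \<in> {0}" using s(1) by (simp add: weight_vec_eq_0_iff)
next
  fix x :: "'v qubits" assume "x \<in> {0}"
  then show "x \<in> rec_kernel Q" using vec.subspace_0[OF subspace_rec_kernel, of Q] by simp
qed


section \<open>Gauging a spanning tree to singlets\<close>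

text \<open>
  The product of \<open>M\<close> with the matrix \<open>(M\<^sub>1\<^sub>2, M\<^sub>2\<^sub>2; - M\<^sub>1\<^sub>1, - M\<^sub>2\<^sub>1)\<close> is \<open>det M\<close> times the symplectic
  matrix, and \<open>g\<^sup>T \<epsilon> g = det g \<epsilon>\<close>.
\<close>

definition gauge_step :: "mat2 \<Rightarrow> mat2 \<Rightarrow> mat2" where
  "gauge_step M g = (\<lambda>a b. if a = 1 then M 1 2 * g 1 b + M 2 2 * g 2 b else - (M 1 1 * g 1 b + M 2 1 * g 2 b))"

lemma det2_gauge_step: "det2 (gauge_step M g) = det2 M * det2 g"
  by (simp add: det2_def gauge_step_def algebra_simps)

lemma antisym2_gauge_step:
  assumes "det2 M \<noteq> 0" "det2 g \<noteq> 0"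
  shows "antisym2 (congr2 g M (gauge_step M g))"
proof -
  have "congr2 g M (gauge_step M g) c d = det2 M * (g 1 c * g 2 d - g 2 c * g 1 d)" for c d
    by (simp add: congr2_def gauge_step_def det2_def sum_2 algebra_simps)
  then show ?thesis using assms
    by (simp add: antisym2_def det2_def[of g]) (simp add: algebra_simps)
qed

text \<open>\<open>ends\<close> may list the new vertex of an edge first, which amounts to
  transposing its matrix. The facts on transposition reduce this case to the other
  orientation.\<close>

lemma congr2_flip: "congr2 g (\<lambda>a b. M b a) h = (\<lambda>a b. congr2 h M g b a)"
  by (intro ext) (simp add: congr2_def sum_2 algebra_simps)

lemma antisym2_flip: "antisym2 (\<lambda>a b. M b a) \<longleftrightarrow> antisym2 M"
  by (auto simp: antisym2_def add_eq_0_iff)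

lemma det2_flip: "det2 (\<lambda>a b. M b a) = det2 M"
  by (simp add: det2_def mult.commute)

lemma det2_id2 [simp]: "det2 id2 \<noteq> 0"
  by (simp add: det2_def id2_def)

lemma measurable_dual_mat:
  assumes "I \<in> E"
  shows "(\<lambda>\<phi>. dual_mat (\<phi> I) a b) \<in> borel_measurable (PiM E (\<lambda>_. uniform_sphere))"
proof -
  have "(\<lambda>y. cnj (y $ (a, b))) \<in> borel_measurable (uniform_sphere :: two_qubits measure)"
    unfolding uniform_sphere_def measurable_distr_eq1
    by (intro borel_measurable_continuous_onI continuous_intros)
  from measurable_compose[OF measurable_component_singleton[OF assms, of "\<lambda>_. uniform_sphere"] this]
  show ?thesis by (simp add: dual_mat_def)
qed

lemma connected_graph_crossing_edge:
  assumes "connected_graph E" "a \<in> S" "b \<notin> S"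
  shows "\<exists>u w. u \<in> S \<and> w \<notin> S \<and> {u, w} \<in> E"
proof (rule ccontr)
  assume no: "\<not> ?thesis"
  have "(a, b) \<in> {(a, b). {a, b} \<in> E}\<^sup>*" using assms(1) by (simp add: connected_graph_def)
  then have "b \<in> S" using assms(2) no by (induction rule: rtrancl_induct) auto
  with assms(3) show False by contradiction
qed

definition gauged :: "('v set \<Rightarrow> 'v \<times> 'v) \<Rightarrow> ('v \<Rightarrow> mat2) \<Rightarrow> ('v set \<Rightarrow> two_qubits) \<Rightarrow> 'v set \<Rightarrow> mat2" where
  "gauged ends h \<phi> I = congr2 (h (fst (ends I))) (dual_mat (\<phi> I)) (h (snd (ends I)))"

text \<open>The invariant for growing a spanning tree: \<open>T\<close> is a tree on
  \<open>S\<close> by connectedness and the edge count, and \<open>h\<close> turns its edges into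
  singlets whenever their matrices are nonsingular. That \<open>h\<close> sees only the amplitudes
  on \<open>T\<close> lets Fubini's theorem resample any other edge with \<open>h\<close>
  fixed.\<close>

definition gauged_tree ::
    "('v set \<Rightarrow> 'v \<times> 'v) \<Rightarrow> 'v set set \<Rightarrow> 'v set \<Rightarrow> 'v set set \<Rightarrow>
      (('v set \<Rightarrow> two_qubits) \<Rightarrow> 'v \<Rightarrow> mat2) \<Rightarrow> bool" where
  "gauged_tree ends E S T h \<longleftrightarrow>
    T \<subseteq> E \<and> (\<forall>I\<in>T. I \<subseteq> S) \<and> card T + 1 = card S \<and>
    (\<forall>u\<in>S. \<forall>v\<in>S. (u, v) \<in> {(a, b). {a, b} \<in> T}\<^sup>*) \<and>
    (\<forall>\<phi> e y. e \<notin> T \<longrightarrow> h (\<phi>(e := y)) = h \<phi>) \<and>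
    (\<forall>v a b. (\<lambda>\<phi>. h \<phi> v a b) \<in> borel_measurable (PiM E (\<lambda>_. uniform_sphere))) \<and>
    (\<forall>\<phi>. (\<forall>I\<in>T. det2 (dual_mat (\<phi> I)) \<noteq> 0) \<longrightarrow>
      (\<forall>v. det2 (h \<phi> v) \<noteq> 0) \<and> (\<forall>I\<in>T. antisym2 (gauged ends (h \<phi>) \<phi> I)))"

text \<open>The tree grows by an edge that leaves \<open>S\<close>; the transformation at its new
  end is computed from the one at its old end.\<close>

lemma exists_gauged_tree:
  fixes E :: "'v::finite set set"
  assumes conn: "connected_graph E"
    and ends: "\<And>I. I \<in> E \<Longrightarrow> {fst (ends I), snd (ends I)} = I"
    and "1 \<le> k" "k \<le> CARD('v)"
  shows "\<exists>S T h. card S = k \<and> gauged_tree ends E S T h"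
  using assms(3,4)
proof (induction k rule: dec_induct)
  case base
  show ?case
    unfolding gauged_tree_def
    by (rule exI[of _ "{undefined}"], rule exI[of _ "{}"], rule exI[of _ "\<lambda>_ _. id2"]) simp
next
  case (step k)
  have "k \<le> CARD('v)" using step.prems by simp
  from step.IH[OF this] obtain S T h where S: "card S = k" and gt: "gauged_tree ends E S T h"
    by blast
  have T: "T \<subseteq> E" "\<And>I. I \<in> T \<Longrightarrow> I \<subseteq> S" "card T + 1 = k"
    and path: "\<And>u v. u \<in> S \<Longrightarrow> v \<in> S \<Longrightarrow> (u, v) \<in> {(a, b). {a, b} \<in> T}\<^sup>*"
    and loc: "\<And>\<phi> e y. e \<notin> T \<Longrightarrow> h (\<phi>(e := y)) = h \<phi>"
    and meas: "\<And>v a b. (\<lambda>\<phi>. h \<phi> v a b) \<in> borel_measurable (PiM E (\<lambda>_. uniform_sphere))"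
    and good: "\<And>\<phi>. \<forall>I\<in>T. det2 (dual_mat (\<phi> I)) \<noteq> 0 \<Longrightarrow>
      (\<forall>v. det2 (h \<phi> v) \<noteq> 0) \<and> (\<forall>I\<in>T. antisym2 (gauged ends (h \<phi>) \<phi> I))"
    using gt S unfolding gauged_tree_def by simp_all
  have "S \<noteq> {}" "S \<noteq> UNIV" using S step by auto
  then obtain u w where uw: "u \<in> S" "w \<notin> S" "{u, w} \<in> E"
    using connected_graph_crossing_edge[OF conn] by blast
  let ?e = "{u, w}"
  have eT: "?e \<notin> T" using T(2) uw by blast
  have une: "u \<noteq> w" using uw by blast
  \<comment> \<open>The matrix of the new edge, read with the old vertex \<open>u\<close>
    first.\<close>
  define N where "N \<phi> = (if ends ?e = (u, w) then dual_mat (\<phi> ?e) else (\<lambda>a b. dual_mat (\<phi> ?e) b a))"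
    for \<phi> :: "'v set \<Rightarrow> two_qubits"
  define h' where "h' \<phi> = (h \<phi>)(w := gauge_step (N \<phi>) (h \<phi> u))" for \<phi>
  let ?r = "{(a, b). {a, b} \<in> insert ?e T}"
  have path': "(a, b) \<in> ?r\<^sup>*" if "a \<in> insert w S" "b \<in> insert w S" for a b
  proof -
    have mono: "(a, b) \<in> ?r\<^sup>*" if "a \<in> S" "b \<in> S" for a b
    proof -
      have "{(a, b). {a, b} \<in> T} \<subseteq> ?r" by auto
      then show ?thesis using path[OF that] rtrancl_mono by blast
    qed
    have 1: "(u, w) \<in> ?r\<^sup>*" "(w, u) \<in> ?r\<^sup>*" by (auto simp: doubleton_eq_iff)
    have "(a, u) \<in> ?r\<^sup>*" using that(1) 1 mono[OF _ uw(1)] by (cases "a = w") simp_all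
    moreover have "(u, b) \<in> ?r\<^sup>*" using that(2) 1 mono[OF uw(1)] by (cases "b = w") simp_all
    ultimately show ?thesis by (rule rtrancl_trans)
  qed
  have loc': "h' (\<phi>(e := y)) = h' \<phi>" if "e \<notin> insert ?e T" for \<phi> e y
  proof -
    have e: "(\<phi>(e := y)) ?e = \<phi> ?e" using that by auto
    have "N (\<phi>(e := y)) = N \<phi>" unfolding N_def e ..
    with that loc show ?thesis by (simp add: h'_def)
  qed
  have meas': "(\<lambda>\<phi>. h' \<phi> v a b) \<in> borel_measurable (PiM E (\<lambda>_. uniform_sphere))" for v a b
  proof (cases "v = w")
    case True
    have [measurable]: "(\<lambda>\<phi>. N \<phi> a b) \<in> borel_measurable (PiM E (\<lambda>_. uniform_sphere))" for a b
      using measurable_dual_mat[OF uw(3)] by (cases "ends ?e = (u, w)") (simp_all add: N_def)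
    note [measurable] = meas
    show ?thesis using True
      by (cases "a = 1") (simp_all add: h'_def gauge_step_def)
  qed (use meas in \<open>simp add: h'_def\<close>)
  have good': "(\<forall>v. det2 (h' \<phi> v) \<noteq> 0) \<and> (\<forall>I\<in>insert ?e T. antisym2 (gauged ends (h' \<phi>) \<phi> I))"
    if nz: "\<And>I. I \<in> insert ?e T \<Longrightarrow> det2 (dual_mat (\<phi> I)) \<noteq> 0" for \<phi>
  proof -
    have g: "\<And>v. det2 (h \<phi> v) \<noteq> 0" "\<And>I. I \<in> T \<Longrightarrow> antisym2 (gauged ends (h \<phi>) \<phi> I)"
      using good[of \<phi>] nz by blast+
    have "det2 (N \<phi>) = det2 (dual_mat (\<phi> ?e))"
      by (cases "ends ?e = (u, w)") (simp_all add: N_def det2_flip[of "dual_mat (\<phi> ?e)"])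
    then have N: "det2 (N \<phi>) \<noteq> 0" using nz[of ?e] by simp
    have "det2 (h' \<phi> v) \<noteq> 0" for v
      using g(1) N by (simp add: h'_def det2_gauge_step)
    moreover have "antisym2 (gauged ends (h' \<phi>) \<phi> ?e)"
    proof (cases "ends ?e = (u, w)")
      case True
      then have "gauged ends (h' \<phi>) \<phi> ?e = congr2 (h \<phi> u) (N \<phi>) (gauge_step (N \<phi>) (h \<phi> u))"
        using une by (simp add: gauged_def h'_def N_def)
      then show ?thesis using antisym2_gauge_step[OF N g(1)] by simp
    next
      case False
      then have "ends ?e = (w, u)"
        using ends[OF uw(3)] by (cases "ends ?e") (auto simp: doubleton_eq_iff)
      moreover have "dual_mat (\<phi> ?e) = (\<lambda>a b. N \<phi> b a)" using False by (simp add: N_def)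
      ultimately have "gauged ends (h' \<phi>) \<phi> ?e
          = (\<lambda>a b. congr2 (h \<phi> u) (N \<phi>) (gauge_step (N \<phi>) (h \<phi> u)) b a)"
        using une by (simp add: gauged_def h'_def congr2_flip[of _ "N \<phi>"])
      then show ?thesis
        using antisym2_gauge_step[OF N g(1)] by (simp only: antisym2_flip[of "congr2 (h \<phi> u) (N \<phi>) _"])
    qed
    \<comment> \<open>The edges of \<open>T\<close> lie inside \<open>S\<close>, so a new
      transformation at \<open>w\<close> leaves them singlets.\<close>
    moreover have "gauged ends (h' \<phi>) \<phi> I = gauged ends (h \<phi>) \<phi> I" if "I \<in> T" for I
    proof -
      have "fst (ends I) \<in> S" "snd (ends I) \<in> S"
        using T(1) T(2)[OF that] ends[of I] that by auto
      then show ?thesis using uw(2) by (auto simp: gauged_def h'_def)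
    qed
    ultimately show ?thesis using g(2) by simp
  qed
  have card: "card (insert w S) = Suc k" "card (insert ?e T) + 1 = Suc k"
    using S uw eT T(3) by simp_all
  have "gauged_tree ends E (insert w S) (insert ?e T) h'"
    unfolding gauged_tree_def card
  proof (intro conjI allI ballI impI)
    show "insert ?e T \<subseteq> E" using uw T by simp
    show "I \<subseteq> insert w S" if "I \<in> insert ?e T" for I using that T(2) uw by blast
    show "(a, b) \<in> ?r\<^sup>*" if "a \<in> insert w S" "b \<in> insert w S" for a b
      using that by (rule path')
    show "h' (\<phi>(e := y)) = h' \<phi>" if "e \<notin> insert ?e T" for \<phi> e y
      using that by (rule loc')
    show "(\<lambda>\<phi>. h' \<phi> v a b) \<in> borel_measurable (PiM E (\<lambda>_. uniform_sphere))" for v a b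
      by (rule meas')
    show "det2 (h' \<phi> v) \<noteq> 0" if "\<forall>I\<in>insert ?e T. det2 (dual_mat (\<phi> I)) \<noteq> 0" for \<phi> v
      using good'[OF bspec[OF that], THEN conjunct1] by (rule spec)
    show "antisym2 (gauged ends (h' \<phi>) \<phi> I)"
      if "\<forall>I\<in>insert ?e T. det2 (dual_mat (\<phi> I)) \<noteq> 0" "I \<in> insert ?e T" for \<phi> I
      using good'[OF bspec[OF that(1)], THEN conjunct2] that(2) by (rule bspec)
  qed (rule refl)
  with card(1) show ?case
    by (intro exI[of _ "insert w S"] exI[of _ "insert ?e T"] exI[of _ h'] conjI)
qed


section \<open>Reduction of the kernel to recurrences, and genericity of the remaining edges\<close>

text \<open>The product transformation pulls every edge constraint back to its gauged form; the tree
  edges then leave the symmetric states and the others impose recurrences. Being injective in finite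
  dimension it is onto, so it reaches the whole kernel.\<close>

lemma op_kernel_gauged:
  fixes E :: "'v::finite set set"
  assumes ends: "\<And>I. I \<in> E \<Longrightarrow> {fst (ends I), snd (ends I)} = I" "\<And>I. I \<in> E \<Longrightarrow> fst (ends I) \<noteq> snd (ends I)"
    and T: "T \<subseteq> E" and conn: "\<And>u v. (u, v) \<in> {(a, b). {a, b} \<in> T}\<^sup>*"
    and h: "\<And>v. det2 (h v) \<noteq> 0" and anti: "\<And>I. I \<in> T \<Longrightarrow> antisym2 (gauged ends h \<phi> I)"
  shows "\<exists>A :: 'v qubits \<Rightarrow> 'v qubits. Vector_Spaces.linear (*s) (*s) A \<and> inj A \<and>
    op_kernel (qsat_hamiltonian ends E \<phi>) = A ` rec_kernel (gauged ends h \<phi> ` (E - T))"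
proof -
  obtain A :: "'v qubits \<Rightarrow> 'v qubits" where lin: "Vector_Spaces.linear (*s) (*s) A" and inj: "inj A"
    and sat: "\<And>i j M \<psi>. i \<noteq> j \<Longrightarrow> edge_sat i j M (A \<psi>) = edge_sat i j (congr2 (h i) M (h j)) \<psi>"
    using exists_local_transformation[of h, OF h] by blast
  have surj: "surj A" using lin inj by (rule vec.linear_inj_imp_surj)
  let ?K = "op_kernel (qsat_hamiltonian ends E \<phi>)"
  have "A \<psi> \<in> ?K \<longleftrightarrow> \<psi> \<in> rec_kernel (gauged ends h \<phi> ` (E - T))" for \<psi>
  proof -
    let ?sat = "\<lambda>I. edge_sat (fst (ends I)) (snd (ends I)) (gauged ends h \<phi> I) \<psi>"
    have "A \<psi> \<in> ?K \<longleftrightarrow> (\<forall>I\<in>E. ?sat I)"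
      using ends(2) by (simp add: op_kernel_qsat_hamiltonian sat gauged_def)
    also have "\<dots> \<longleftrightarrow> (\<forall>I\<in>T. ?sat I) \<and> (\<forall>I\<in>E - T. ?sat I)"
      using T by blast
    also have "(\<forall>I\<in>T. ?sat I) \<longleftrightarrow> \<psi> \<in> range weight_vec"
      using T by (intro edge_sat_connected_iff conn ends anti) auto
    also have "\<psi> \<in> range weight_vec \<and> (\<forall>I\<in>E - T. ?sat I) \<longleftrightarrow> \<psi> \<in> rec_kernel (gauged ends h \<phi> ` (E - T))"
      using ends(2) by (auto simp: rec_kernel_def edge_sat_weight_vec)
    finally show ?thesis .
  qed
  then have "?K = A ` rec_kernel (gauged ends h \<phi> ` (E - T))"
    using surj by (auto simp: image_iff) (metis surjD)
  with lin inj show ?thesis by (intro exI[of _ A]) simp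
qed

text \<open>The characteristic polynomial of the recurrence, and also the bilinear form
  \<open>M\<close> with the vector \<open>(1, x)\<close> in both arguments.\<close>

definition quad2 :: "mat2 \<Rightarrow> complex \<Rightarrow> complex" where
  "quad2 M x = M 1 1 + (M 1 2 + M 2 1) * x + M 2 2 * x\<^sup>2"

text \<open>The resultant is, up to a power of the leading coefficient, the product of the values of
  one polynomial at the roots \<open>l\<close> and \<open>m\<close> of the other. For fixed
  \<open>N\<close> it is thus a product of two linear forms in the entries of
  \<open>M\<close>.\<close>

lemma resultant2_factor:
  assumes "N 2 2 \<noteq> 0"
  shows "\<exists>l m. \<forall>M. resultant2 M N = (N 2 2)\<^sup>2 * quad2 M l * quad2 M m"
proof -
  define b0 b1 b2 where b: "b0 = N 1 1" "b1 = N 1 2 + N 2 1" "b2 = N 2 2"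
  define d where "d = csqrt (b1\<^sup>2 - 4 * b0 * b2)"
  define l m where lm: "l = (- b1 + d) / (2 * b2)" "m = (- b1 - d) / (2 * b2)"
  have b2: "b2 \<noteq> 0" using assms b by simp
  have d2: "d\<^sup>2 = b1\<^sup>2 - 4 * b0 * b2" by (simp add: d_def)
  have b1: "b1 = - b2 * (l + m)"
    using b2 by (simp add: lm field_simps)
  have "4 * b2\<^sup>2 * (l * m) = (- b1 + d) * (- b1 - d)"
    using b2 by (simp add: lm power2_eq_square)
  also have "\<dots> = 4 * b0 * b2"
    using d2 by (simp add: algebra_simps power2_eq_square)
  finally have b0: "b0 = b2 * (l * m)"
    using b2 by (simp add: power2_eq_square)
  have "resultant2 M N = (N 2 2)\<^sup>2 * quad2 M l * quad2 M m" for M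
    unfolding resultant2_def quad2_def b[symmetric] b0 b1 by algebra
  then show ?thesis by blast
qed

lemma AE_bilinear_form_nonzero:
  assumes "x \<noteq> (\<lambda>_. 0)" "z \<noteq> (\<lambda>_. 0)"
  shows "AE y in uniform_sphere. (\<Sum>a\<in>UNIV. \<Sum>b\<in>UNIV. x a * dual_mat y a b * z b) \<noteq> 0"
proof -
  have "(\<lambda>a b. x a * z b) \<noteq> (\<lambda>_ _. 0)" using assms by (auto simp: fun_eq_iff)
  from AE_uniform_sphere_linear_form[OF this] show ?thesis
    by (simp add: dual_mat_def mult.assoc mult.left_commute mult.commute)
qed

text \<open>The corner is the bilinear form of \<open>y\<close> at the second columns of
  \<open>g\<close> and \<open>h\<close>, which are nonzero by invertibility.\<close>

lemma AE_congr2_corner: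
  assumes "det2 g \<noteq> 0" "det2 h \<noteq> 0"
  shows "AE y in uniform_sphere. congr2 g (dual_mat y) h 2 2 \<noteq> 0"
proof -
  have "(\<lambda>a. g a 2) \<noteq> (\<lambda>_. 0)" "(\<lambda>a. h a 2) \<noteq> (\<lambda>_. 0)"
    using assms unfolding det2_def by (metis mult_zero_left mult_zero_right diff_self)+
  from AE_bilinear_form_nonzero[OF this] show ?thesis by (simp add: congr2_def)
qed

text \<open>The value at \<open>l\<close> is the bilinear form of \<open>y\<close> at the images of
  \<open>(1, l)\<close> under \<open>g\<close> and \<open>h\<close>, again nonzero vectors.\<close>

lemma AE_quad2_congr2:
  assumes "det2 g \<noteq> 0" "det2 h \<noteq> 0"
  shows "AE y in uniform_sphere. quad2 (congr2 g (dual_mat y) h) l \<noteq> 0"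
proof -
  have nz: "(\<lambda>a. k a 1 + l * k a 2) \<noteq> (\<lambda>_. 0)" if "det2 k \<noteq> 0" for k :: mat2
  proof
    assume "(\<lambda>a. k a 1 + l * k a 2) = (\<lambda>_. 0)"
    then have "k 1 1 + l * k 1 2 = 0" "k 2 1 + l * k 2 2 = 0" by (simp_all add: fun_eq_iff)
    then have "det2 k = 0" unfolding det2_def by algebra
    with that show False by contradiction
  qed
  have "quad2 (congr2 g (dual_mat y) h) l
      = (\<Sum>a\<in>UNIV. \<Sum>b\<in>UNIV. (g a 1 + l * g a 2) * dual_mat y a b * (h b 1 + l * h b 2))" for y
    by (simp add: quad2_def congr2_def sum_2 power2_eq_square algebra_simps)
  with AE_bilinear_form_nonzero[OF nz[OF assms(1)] nz[OF assms(2)]] show ?thesis by simp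
qed

lemma AE_det2_dual_mat: "AE y in uniform_sphere. det2 (dual_mat y) \<noteq> 0"
proof -
  have "det2 (dual_mat y) = cnj (y $ (1, 1) * y $ (2, 2) - y $ (1, 2) * y $ (2, 1))" for y
    by (simp add: det2_def dual_mat_def)
  then show ?thesis using AE_uniform_sphere_det by (simp del: complex_cnj_diff)
qed

section \<open>Almost sure nondegeneracy of an instance and the three cases by the number of
  loops\<close>

theorem mainTheorem3:
  fixes E :: "'v::finite set set" and ends :: "'v set \<Rightarrow> 'v \<times> 'v" and n n\<^sub>L :: nat
  assumes "n = CARD('v)" and "n \<ge> 2"
    and "simple_graph E" and "connected_graph E"
    and "card E = n - 1 + n\<^sub>L"
    and "\<forall>I\<in>E. {fst (ends I), snd (ends I)} = I"
  shows "AE \<phi> in random_2qsat E.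
    (n\<^sub>L = 0 \<longrightarrow> vec.dim (op_kernel (qsat_hamiltonian ends E \<phi>)) = n + 1) \<and>
    (n\<^sub>L = 1 \<longrightarrow> vec.dim (op_kernel (qsat_hamiltonian ends E \<phi>)) = 2) \<and>
    (n\<^sub>L \<ge> 2 \<longrightarrow> op_kernel (qsat_hamiltonian ends E \<phi>) = {0})"
proof -
  let ?U = "uniform_sphere :: two_qubits measure"
  let ?P = "PiM E (\<lambda>_. ?U)"
  have ends: "\<And>I. I \<in> E \<Longrightarrow> {fst (ends I), snd (ends I)} = I" using assms(6) by blast
  have ends_neq: "fst (ends I) \<noteq> snd (ends I)" if "I \<in> E" for I
  proof
    assume "fst (ends I) = snd (ends I)"
    then have "I = {fst (ends I)}" using ends[OF that] by simp
    then have "card I = 1" by (metis is_singletonI is_singleton_altdef)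
    then show False using assms(3) that by (simp add: simple_graph_def)
  qed
  obtain S T h where S: "card S = n" and gt: "gauged_tree ends E S T h"
    using exists_gauged_tree[OF assms(4) ends, of n] assms(1,2) by auto
  then have T: "T \<subseteq> E" "card T + 1 = n"
    and path: "\<forall>u\<in>S. \<forall>v\<in>S. (u, v) \<in> {(a, b). {a, b} \<in> T}\<^sup>*"
    and loc: "\<And>\<phi> e y. e \<notin> T \<Longrightarrow> h (\<phi>(e := y)) = h \<phi>"
    and meas: "\<And>v a b. (\<lambda>\<phi>. h \<phi> v a b) \<in> borel_measurable ?P"
    and good: "\<And>\<phi>. \<forall>I\<in>T. det2 (dual_mat (\<phi> I)) \<noteq> 0 \<Longrightarrow>
      (\<forall>v. det2 (h \<phi> v) \<noteq> 0) \<and> (\<forall>I\<in>T. antisym2 (gauged ends (h \<phi>) \<phi> I))"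
    unfolding gauged_tree_def by simp_all
  have "S = UNIV" using S assms(1) by (simp add: card_eq_UNIV_imp_eq_UNIV)
  with path have conn: "(u, v) \<in> {(a, b). {a, b} \<in> T}\<^sup>*" for u v by blast
  \<comment> \<open>The tree uses \<open>n - 1\<close> edges, so one recurrence remains for each
    independent loop.\<close>
  have cardET: "card (E - T) = n\<^sub>L"
    using T assms(2,5) by (simp add: card_Diff_subset)
  define nondeg where "nondeg \<phi> \<longleftrightarrow> (\<forall>I\<in>T. det2 (dual_mat (\<phi> I)) \<noteq> 0)" for \<phi> :: "'v set \<Rightarrow> two_qubits"
  define G where "G \<phi> = gauged ends (h \<phi>) \<phi>" for \<phi>
  have det_h: "det2 (h \<phi> v) \<noteq> 0" if "nondeg \<phi>" for \<phi> v
    using good that by (simp add: nondeg_def)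
  have nondeg_upd: "nondeg (\<phi>(e := y)) \<longleftrightarrow> nondeg \<phi>" if "e \<notin> T" for \<phi> e y
  proof -
    have "(\<phi>(e := y)) I = \<phi> I" if "I \<in> T" for I using that \<open>e \<notin> T\<close> by auto
    then show ?thesis by (simp add: nondeg_def)
  qed
  \<comment> \<open>Since \<open>h\<close> ignores an edge \<open>e\<close> outside
    \<open>T\<close>, resampling \<open>e\<close> changes only the middle factor of its own gauged
    matrix and no other gauged matrix.\<close>
  have G_upd: "G (\<phi>(e := y)) e = congr2 (h \<phi> (fst (ends e))) (dual_mat y) (h \<phi> (snd (ends e)))"
    if "e \<notin> T" for \<phi> e y
    using loc[OF that] by (simp add: G_def gauged_def)
  have G_upd_other: "G (\<phi>(e := y)) f = G \<phi> f" if "e \<notin> T" "f \<noteq> e" for \<phi> e f y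
    using loc[OF that(1)] that(2) by (simp add: G_def gauged_def)
  have [measurable]: "(\<lambda>\<phi>. dual_mat (\<phi> I) a b) \<in> borel_measurable ?P" if "I \<in> E" for I a b
    using that by (rule measurable_dual_mat)
  note meas[measurable]
  have meas_G[measurable]: "(\<lambda>\<phi>. G \<phi> I a b) \<in> borel_measurable ?P" if [simp]: "I \<in> E" for I a b
    unfolding G_def gauged_def congr2_def by measurable
  have meas_det: "(\<lambda>\<phi>. det2 (dual_mat (\<phi> I))) \<in> borel_measurable ?P" if [simp]: "I \<in> E" for I
    unfolding det2_def by measurable
  have meas_nondeg[measurable]: "Measurable.pred ?P nondeg"
  proof -
    have "finite T" by simp
    moreover have "Measurable.pred ?P (\<lambda>\<phi>. det2 (dual_mat (\<phi> I)) \<noteq> 0)" if "I \<in> T" for I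
      using meas_det[of I] that T(1) by (simp add: subset_iff)
    ultimately show ?thesis
      unfolding nondeg_def[abs_def] by (rule pred_intros_finite)
  qed
  have fin: "finite E" by simp
  note fibre = AE_PiM_fibre[OF fin _ prob_space_uniform_sphere]
  have AE_nondeg: "AE \<phi> in ?P. nondeg \<phi>"
    unfolding nondeg_def
  proof (rule AE_finite_allI)
    fix I assume "I \<in> T"
    then have I: "I \<in> E" using T by blast
    show "AE \<phi> in ?P. det2 (dual_mat (\<phi> I)) \<noteq> 0"
    proof (rule fibre[OF I])
      show "{\<phi> \<in> space ?P. det2 (dual_mat (\<phi> I)) \<noteq> 0} \<in> sets ?P"
        using meas_det[OF I] by simp
      show "AE y in ?U. det2 (dual_mat ((\<phi>(I := y)) I)) \<noteq> 0" for \<phi> :: "'v set \<Rightarrow> two_qubits"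
        using AE_det2_dual_mat by simp
    qed
  qed simp
  \<comment> \<open>\<open>nondeg\<close> stays a premise inside the event because the fibre
    argument asks for a claim at every \<open>\<phi>\<close>; resampling \<open>e\<close> does not
    affect it.\<close>
  have AE_corner: "AE \<phi> in ?P. nondeg \<phi> \<longrightarrow> G \<phi> e 2 2 \<noteq> 0" if e: "e \<in> E - T" for e
  proof (rule fibre)
    show "e \<in> E" using e by blast
    then have [measurable]: "(\<lambda>\<phi>. G \<phi> e 2 2) \<in> borel_measurable ?P" by (rule meas_G)
    show "{\<phi> \<in> space ?P. nondeg \<phi> \<longrightarrow> G \<phi> e 2 2 \<noteq> 0} \<in> sets ?P" by measurable
    show "AE y in ?U. nondeg (\<phi>(e := y)) \<longrightarrow> G (\<phi>(e := y)) e 2 2 \<noteq> 0" for \<phi>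
    proof (cases "nondeg \<phi>")
      case True
      then show ?thesis
        using AE_congr2_corner[OF det_h det_h, OF True True] e by (simp add: nondeg_upd G_upd)
    qed (use e in \<open>simp add: nondeg_upd\<close>)
  qed
  have AE_res: "AE \<phi> in ?P. nondeg \<phi> \<and> G \<phi> f 2 2 \<noteq> 0 \<longrightarrow> resultant2 (G \<phi> e) (G \<phi> f) \<noteq> 0"
    if e: "e \<in> E - T" and f: "f \<in> E - T" and ef: "f \<noteq> e" for e f
  proof (rule fibre)
    show eE: "e \<in> E" using e by blast
    have fE: "f \<in> E" using f by blast
    note [measurable] = meas_G[OF eE] meas_G[OF fE]
    have [measurable]: "(\<lambda>\<phi>. resultant2 (G \<phi> e) (G \<phi> f)) \<in> borel_measurable ?P"
      unfolding resultant2_def by measurable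
    show "{\<phi> \<in> space ?P. nondeg \<phi> \<and> G \<phi> f 2 2 \<noteq> 0 \<longrightarrow> resultant2 (G \<phi> e) (G \<phi> f) \<noteq> 0} \<in> sets ?P"
      by measurable
    show "AE y in ?U. nondeg (\<phi>(e := y)) \<and> G (\<phi>(e := y)) f 2 2 \<noteq> 0 \<longrightarrow>
        resultant2 (G (\<phi>(e := y)) e) (G (\<phi>(e := y)) f) \<noteq> 0" for \<phi>
    proof (cases "nondeg \<phi> \<and> G \<phi> f 2 2 \<noteq> 0")
      case True
      \<comment> \<open>The roots belong to the polynomial of \<open>f\<close>, which stays fixed
        while \<open>e\<close> is resampled.\<close>
      then obtain l m where lm: "\<And>M. resultant2 M (G \<phi> f) = (G \<phi> f 2 2)\<^sup>2 * quad2 M l * quad2 M m"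
        using resultant2_factor by blast
      have nd: "nondeg \<phi>" using True by blast
      show ?thesis
        using
          AE_quad2_congr2[OF det_h[OF nd, of "fst (ends e)"] det_h[OF nd, of "snd (ends e)"], where l=l]
          AE_quad2_congr2[OF det_h[OF nd, of "fst (ends e)"] det_h[OF nd, of "snd (ends e)"], where l=m]
      proof eventually_elim
        case (elim y)
        have eT: "e \<notin> T" using e by blast
        show ?case
          unfolding G_upd_other[OF eT ef] G_upd[OF eT] lm using elim True by simp
      qed
    next
      case False
      then have "\<not> (nondeg (\<phi>(e := y)) \<and> G (\<phi>(e := y)) f 2 2 \<noteq> 0)" for y
        using e ef by (simp add: nondeg_upd G_upd_other)
      then show ?thesis by (intro AE_I2) blast
    qed
  qed
  have "AE \<phi> in ?P. \<forall>e\<in>E - T. nondeg \<phi> \<longrightarrow> G \<phi> e 2 2 \<noteq> 0"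
    using AE_corner by (intro AE_finite_allI) auto
  moreover have "AE \<phi> in ?P. \<forall>e\<in>E - T. \<forall>f\<in>E - T - {e}.
      nondeg \<phi> \<and> G \<phi> f 2 2 \<noteq> 0 \<longrightarrow> resultant2 (G \<phi> e) (G \<phi> f) \<noteq> 0"
  proof (intro AE_finite_allI)
    fix e f assume "e \<in> E - T" "f \<in> E - T - {e}"
    then show "AE \<phi> in ?P. nondeg \<phi> \<and> G \<phi> f 2 2 \<noteq> 0 \<longrightarrow> resultant2 (G \<phi> e) (G \<phi> f) \<noteq> 0"
      by (intro AE_res) auto
  qed simp_all
  ultimately show ?thesis
    using AE_nondeg unfolding random_2qsat_def
  proof eventually_elim
    case (elim \<phi>)
    let ?K = "op_kernel (qsat_hamiltonian ends E \<phi>)"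
    have corner: "G \<phi> e 2 2 \<noteq> 0" if "e \<in> E - T" for e
      using elim(1,3) that by blast
    have res: "resultant2 (G \<phi> e) (G \<phi> f) \<noteq> 0" if "e \<in> E - T" "f \<in> E - T" "f \<noteq> e" for e f
      using elim(2,3) corner that by blast
    obtain A :: "'v qubits \<Rightarrow> 'v qubits" where A: "Vector_Spaces.linear (*s) (*s) A" "inj A" and K: "?K = A ` rec_kernel (G \<phi> ` (E - T))"
    proof -
      have "\<exists>A :: 'v qubits \<Rightarrow> 'v qubits. Vector_Spaces.linear (*s) (*s) A \<and> inj A \<and> ?K = A ` rec_kernel (G \<phi> ` (E - T))"
        unfolding G_def
      proof (rule op_kernel_gauged[OF ends ends_neq T(1) conn det_h[OF elim(3)]])
        show "antisym2 (gauged ends (h \<phi>) \<phi> I)" if "I \<in> T" for I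
          using good[of \<phi>] elim(3) that unfolding nondeg_def by blast
      qed
      then show ?thesis using that by blast
    qed
    have dim: "vec.dim ?K = vec.dim (rec_kernel (G \<phi> ` (E - T)) :: 'v qubits set)"
      unfolding K using A(1) inj_on_subset[OF A(2)] by (intro vec.dim_image_eq) auto
    show ?case
    proof (intro conjI impI)
      assume "n\<^sub>L = 0"
      then have "E - T = {}" using cardET by (metis card_0_eq finite)
      then show "vec.dim ?K = n + 1" using assms(1) by (simp only: dim image_empty dim_rec_kernel_empty)
    next
      assume "n\<^sub>L = 1"
      then obtain e where e: "E - T = {e}" using cardET by (metis card_1_singletonE)
      then show "vec.dim ?K = 2" using corner[of e] dim by (simp add: dim_rec_kernel_single)
    next
      assume nL: "2 \<le> n\<^sub>L"
      then obtain e f where ef: "e \<in> E - T" "f \<in> E - T" "f \<noteq> e"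
        using cardET card_le_Suc0_iff_eq[of "E - T"] by auto
      \<comment> \<open>Two vertices admit only one edge, while \<open>e\<close> and
        \<open>f\<close> are distinct.\<close>
      have "CARD('v) \<ge> 3"
      proof (rule ccontr)
        assume "\<not> ?thesis"
        then have n2: "CARD('v) = 2" using assms(1,2) by linarith
        have "I = UNIV" if "I \<in> E" for I
          using that assms(3) n2 by (intro card_eq_UNIV_imp_eq_UNIV) (simp_all add: simple_graph_def)
        then show False using ef by blast
      qed
      then have "rec_kernel (G \<phi> ` (E - T)) = {0 :: 'v qubits}"
        using res[OF ef] ef by (intro rec_kernel_trivial[of "G \<phi> e" "G \<phi> f"]) auto
      moreover have "A 0 = 0"
        using A(1) by (rule vec.linear_0)
      ultimately show "?K = {0}" unfolding K by simp
    qed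
  qed
qed

end
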